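(* Let $R\subseteq\mathbb{T}$ be a set of tapes and let $x$ and $y$ be representations of a countable set $A$. (i) If $x(A)$ and $y(A)$ are $R$-c.e., then either $x$ and $y$ are $R$-transformationally equivalent, or neither $\mathrm{comp}^R(x)\subseteq\mathrm{comp}^R(y)$ nor $\mathrm{comp}^R(y)\subseteq\mathrm{comp}^R(x)$. (ii) If $e:A\to A$ and $a_0\in A$ are such that every $a\in A$ equals $e^i(a_0)$ for some $i$, and $e\in\mathrm{comp}^R(x)$ and $e\in\mathrm{comp}^R(y)$, then $x$ and $y$ are $R$-transformationally equivalent.
   Context: $\mathbb{T}$ denotes the set of tapes over a fixed finite alphabet with finitely many non-blank symbols. A Turing machine with oracle $R\subseteq\mathbb{T}$ is a Turing machine with an extra operation which, given a tape $\tau$, tells whether $\tau\in R$. For $Q\subseteq\mathbb{T}$, a function with domain $Q$ is $R$-computable if some Turing machine with oracle $R$, on every input $\tau\in Q$, halts with output equal to the function's value (nothing required outside $Q$). A set $Q\subseteq\mathbb{T}$ is $R$-c.e. if there are an $R$-computable $h$ with domain $Q$ and values in $Q$ and $\tau_0\in Q$ such that every element of $Q$ is $h^i(\tau_0)$ for some $i$. A representation of $A$ is an injective function $A\to\mathbb{T}$. $\mathrm{comp}^R(x)$ is the set of functions $g$ with domain $A$ and values in $A$ such that $x\circ g\circ x^{-1}$ is $R$-computable on $x(A)$. Representations $x,y$ are $R$-transformationally equivalent if $y\circ x^{-1}$ (on $x(A)$) and $x\circ y^{-1}$ (on $y(A)$) are both $R$-computable. Standing assumptions: a fixed tape pairing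 bijection with computable duplication, swap, projections and partial application, and a Turing machine deciding equality of the two components of a pair. *)

theory Defs
  imports Main "HOL-Library.Countable_Set" "HOL-Library.FuncSet"
begin

class alphabet = finite +
  fixes blank :: 'a

(* Two-way infinite tapes with finitely many non-blank symbols; the head is at cell 0,
   so that moving the head amounts to shifting the tape. *)

typedef (overloaded) ('s::alphabet) tape = "{g :: int \<Rightarrow> 's. finite {i. g i \<noteq> blank}}"
  morphisms cell Tape
  by (rule exI[of _ "\<lambda>_. blank"]) simp

(* Turing machines with several tapes.  A machine tape is a finite written segment; None marks
   the cells outside of it.  A machine that could not tell where the non-blank part of its input
   ends would see only a finite window of the input before it halts, and then equality of tapes
   would not be decidable.  Several tapes let a machine keep data while it puts a query to the
   oracle.

   A state is an index into the list of instructions, 0 is the initial state, and every index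
   beyond the end of the list is a halting state.  Act k d reads the scanned cell of tape k,
   writes a symbol to it, moves the head of tape k and changes the state.  Query k p q goes to
   state p or q depending on whether the oracle contains the current contents of tape k. *)

type_synonym 's mtape = "int \<Rightarrow> 's option"

datatype move = Left | Stay | Right

datatype 's instr =
  Act nat "'s option \<Rightarrow> 's \<times> move \<times> nat"
| Query nat nat nat

type_synonym 's machine = "'s instr list"

type_synonym 's config = "nat \<times> (nat \<Rightarrow> 's mtape)"

fun offset :: "move \<Rightarrow> int" where
  "offset Left = - 1"
| "offset Stay = 0"
| "offset Right = 1"

definition act_tape :: "'s \<Rightarrow> move \<Rightarrow> 's mtape \<Rightarrow> 's mtape" where
  "act_tape s m t = (\<lambda>i. (t(0 := Some s)) (i + offset m))"

definition content :: "'s::alphabet mtape \<Rightarrow> int \<Rightarrow> 's" where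
  "content t = (\<lambda>i. case t i of None \<Rightarrow> blank | Some s \<Rightarrow> s)"

fun step :: "'s::alphabet tape set \<Rightarrow> 's machine \<Rightarrow> 's config \<Rightarrow> 's config" where
  "step R M (q, c) =
    (if q < length M then
       (case M ! q of
          Act k d \<Rightarrow> (case d (c k 0) of (s, m, q') \<Rightarrow> (q', c(k := act_tape s m (c k))))
        | Query k q1 q2 \<Rightarrow> (if content (c k) \<in> cell ` R then q1 else q2, c))
     else (q, c))"

(* The written segment is a finite interval that contains the head. *)

definition presents :: "'s::alphabet mtape \<Rightarrow> (int \<Rightarrow> 's) \<Rightarrow> bool" where
  "presents t g \<longleftrightarrow> (\<exists>l r. l \<le> 0 \<and> 0 \<le> r \<and> {i. t i \<noteq> None} = {l..r}) \<and> content t = g"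

(* Input and output are on tape 0, all other tapes are initially blank.  The choice of the
   initial segments must not matter. *)

definition outputs ::
  "'s::alphabet tape set \<Rightarrow> 's machine \<Rightarrow> 's tape \<Rightarrow> 's tape \<Rightarrow> bool" where
  "outputs R M \<tau> \<upsilon> \<longleftrightarrow>
    (\<forall>c. presents (c 0) (cell \<tau>) \<and> (\<forall>k>0. presents (c k) (\<lambda>_. blank)) \<longrightarrow>
      (\<exists>n q c'. (step R M ^^ n) (0, c) = (q, c') \<and> length M \<le> q \<and> content (c' 0) = cell \<upsilon>))"

definition computable_on ::
  "'s::alphabet tape set \<Rightarrow> 's tape set \<Rightarrow> ('s tape \<Rightarrow> 's tape) \<Rightarrow> bool" where
  "computable_on R Q f \<longleftrightarrow> (\<exists>M. \<forall>\<tau>\<in>Q. outputs R M \<tau> (f \<tau>))"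

definition ce :: "'s::alphabet tape set \<Rightarrow> 's tape set \<Rightarrow> bool" where
  "ce R Q \<longleftrightarrow> (\<exists>h \<tau>0. computable_on R Q h \<and> h \<in> Q \<rightarrow> Q \<and> \<tau>0 \<in> Q \<and>
     (\<forall>\<tau>\<in>Q. \<exists>i. \<tau> = (h ^^ i) \<tau>0))"

definition representation :: "'a set \<Rightarrow> ('a \<Rightarrow> 's::alphabet tape) \<Rightarrow> bool" where
  "representation A x \<longleftrightarrow> inj_on x A"

definition comp_funs ::
  "'s::alphabet tape set \<Rightarrow> 'a set \<Rightarrow> ('a \<Rightarrow> 's tape) \<Rightarrow> ('a \<Rightarrow> 'a) set" where
  "comp_funs R A x = {g \<in> A \<rightarrow>\<^sub>E A. computable_on R (x ` A) (x \<circ> g \<circ> inv_into A x)}"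

definition trans_equiv ::
  "'s::alphabet tape set \<Rightarrow> 'a set \<Rightarrow> ('a \<Rightarrow> 's tape) \<Rightarrow> ('a \<Rightarrow> 's tape) \<Rightarrow> bool" where
  "trans_equiv R A x y \<longleftrightarrow>
    computable_on R (x ` A) (y \<circ> inv_into A x) \<and> computable_on R (y ` A) (x \<circ> inv_into A y)"

end

(* Suppose e generates A from a0, and e is computable in both representations.  To translate x a
   into y a, enumerate the pairs (x (e^i a0), y (e^i a0)) by running the two machines for e side by
   side until the first component equals the input; then output the second one.  This gives (ii).
   For (i), if comp x is contained in comp y, then the enumeration h of x A is the image of some e
   in comp x, which generates A and lies in comp y, so that (ii) applies; conversely, composition
   with the translations shows that equivalent representations have the same computable functions.

   The tapes are compared and copied cell by cell, with a third tape that marks the origin.  The mark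
   needs a non-blank symbol; if there is none, then there is only one tape. *)

theory Submission
  imports Defs
begin

section \<open>Runs and relocation of machines\<close>

text \<open>The machines for \<open>e\<close> are iterated an unbounded number of times inside one
  computation, so a subroutine must hand back tapes that are legal initial tapes again: blank work
  tapes and a written scanned cell. Blanking a tape of unknown length is possible because the
  written cells always form an interval at or next to the head (\<open>seg\<close>), so that running
  off its end certifies that nothing lies beyond. Since \<open>outputs\<close> quantifies over all
  initial written segments, the segments left over from earlier calls do no harm, and the invariants
  speak only of contents, of contiguity and of a few cells known to be written. The search stops at
  the first index whose \<open>x\<close>-component equals the input. Injectivity of \<open>x\<close>
  makes the \<open>y\<close>-component at this index the right one, even if the orbit of
  \<open>a0\<close> is finite and repeats. The current pair is kept in two blocks of tapes, to which
  the machines are moved by renaming their tapes, so that no pairing of tapes is encoded.\<close>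

definition reach :: "'s::alphabet tape set \<Rightarrow> 's machine \<Rightarrow> 's config \<Rightarrow> 's config \<Rightarrow> bool" where
  "reach R M s s' \<longleftrightarrow> (\<exists>n. (step R M ^^ n) s = s')"

lemma reach_refl [simp]: "reach R M s s"
  unfolding reach_def by (rule exI[of _ 0]) simp

lemma reach_trans:
  assumes "reach R M s s'" "reach R M s' s''"
  shows "reach R M s s''"
proof -
  obtain n n' where "(step R M ^^ n) s = s'" "(step R M ^^ n') s' = s''"
    using assms unfolding reach_def by blast
  then have "(step R M ^^ (n' + n)) s = s''" by (simp add: funpow_add del: step.simps)
  then show ?thesis unfolding reach_def by blast
qed

lemma reach_step1: "step R M s = s' \<Longrightarrow> reach R M s s'"
  unfolding reach_def by (rule exI[of _ 1]) (simp del: step.simps)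

lemma reach_step: "reach R M (step R M s) s' \<Longrightarrow> reach R M s s'"
  by (rule reach_trans[OF reach_step1[OF refl]])

text \<open>Induction from the end of the run backwards: the claim is available for the
  configuration after the first step.\<close>

lemma reach_induct [consumes 1, case_names refl step]:
  assumes "reach R M s s'"
    and "P s'"
    and "\<And>s. reach R M (step R M s) s' \<Longrightarrow> P (step R M s) \<Longrightarrow> P s"
  shows "P s"
proof -
  obtain n where "(step R M ^^ n) s = s'" using assms(1) reach_def by blast
  then show ?thesis
  proof (induction n arbitrary: s)
    case 0
    then show ?case using assms(2) by simp
  next
    case (Suc n)
    then have n: "(step R M ^^ n) (step R M s) = s'"
      by (simp add: funpow_swap1)
    then show ?case using Suc.IH assms(3) reach_def by blast
  qed
qed

fun relabel :: "(nat \<Rightarrow> nat) \<Rightarrow> 's instr \<Rightarrow> 's instr" where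
  "relabel f (Act k d) = Act k (\<lambda>a. case d a of (s, m, q) \<Rightarrow> (s, m, f q))"
| "relabel f (Query k p q) = Query k (f p) (f q)"

lemma relabel_id [simp]: "relabel (\<lambda>q. q) i = i"
  by (cases i) auto

lemma step_relabel:
  assumes "q < length P" "f q < length M" "M ! f q = relabel f (P ! q)"
  shows "step R M (f q, c) = (case step R P (q, c) of (q', c') \<Rightarrow> (f q', c'))"
  using assms by (cases "P ! q") (auto split: prod.splits)

text \<open>Only the states below \<open>length P\<close> are constrained, so the image of the exit
  state is a free choice. Sequencing, branching and looping differ in where they send it.\<close>

lemma reach_embed:
  assumes "reach R P (q, c) (q', c')"
    and emb: "\<And>q. q < length P \<Longrightarrow> f q < length M \<and> M ! f q = relabel f (P ! q)"
  shows "reach R M (f q, c) (f q', c')"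
proof -
  have "reach R P s s' \<Longrightarrow> reach R M (f (fst s), snd s) (f (fst s'), snd s')" for s s'
  proof (induction rule: reach_induct)
    case refl
    show ?case by simp
  next
    case (step s)
    obtain q c where s: "s = (q, c)" by fastforce
    show ?case
    proof (cases "q < length P")
      case True
      then have "step R M (f q, c) = (f (fst (step R P s)), snd (step R P s))"
        using step_relabel[of q P f M R c] emb s by (simp split: prod.splits)
      then show ?thesis using step.IH s by (metis fst_conv reach_step snd_conv)
    next
      case False
      then show ?thesis using step.IH s by simp
    qed
  qed
  from this[OF assms(1)] show ?thesis by simp
qed

section \<open>Program fragments\<close>

text \<open>A fragment leaves at exactly \<open>length P\<close>, not at an arbitrary halting state,
  so that this one state can be joined to what follows.\<close>

definition exec ::
  "'s::alphabet tape set \<Rightarrow> 's machine \<Rightarrow> (nat \<Rightarrow> 's mtape) \<Rightarrow> (nat \<Rightarrow> 's mtape) \<Rightarrow> bool" where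
  "exec R P c c' \<longleftrightarrow> reach R P (0, c) (length P, c')"

abbreviation sym :: "'s::alphabet option \<Rightarrow> 's" where
  "sym a \<equiv> (case a of None \<Rightarrow> blank | Some s \<Rightarrow> s)"

definition put :: "'s \<Rightarrow> 's mtape \<Rightarrow> 's mtape" where
  "put s t = t(0 := Some s)"

(* Reading a cell always writes it, so a test turns an unwritten scanned cell into a blank one. *)

definition fill :: "'s::alphabet mtape \<Rightarrow> 's mtape" where
  "fill t = put (content t 0) t"

definition shift :: "move \<Rightarrow> 's::alphabet mtape \<Rightarrow> 's mtape" where
  "shift d t = act_tape (content t 0) d t"

lemma act_tape_Stay: "act_tape s Stay t = put s t"
  by (auto simp: act_tape_def put_def)

lemma sym_eq_content: "sym (t 0) = content t 0"
  by (simp add: content_def)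

lemma content_put: "content (put s t) = (content t)(0 := s)"
  by (auto simp: content_def put_def)

lemma content_fill [simp]: "content (fill t) = content t"
  by (auto simp: fill_def content_put)

lemma content_shift: "content (shift d t) i = content t (i + offset d)"
  by (auto simp: content_def shift_def act_tape_def)

lemma fill_written [simp]: "t 0 \<noteq> None \<Longrightarrow> fill t = t"
  by (auto simp: fill_def put_def content_def)

lemma fill_neq_None: "t i \<noteq> None \<Longrightarrow> fill t i \<noteq> None"
  by (auto simp: fill_def put_def)

lemma fill_0 [simp]: "fill t 0 = Some (content t 0)"
  by (simp add: fill_def put_def)

definition wr :: "nat \<Rightarrow> 's \<Rightarrow> 's machine" where
  "wr k s = [Act k (\<lambda>_. (s, Stay, 1))]"

definition mv :: "nat \<Rightarrow> move \<Rightarrow> 's::alphabet machine" where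
  "mv k d = [Act k (\<lambda>a. (sym a, d, 1))]"

definition seq :: "'s machine \<Rightarrow> 's machine \<Rightarrow> 's machine" (infixr ";;" 60) where
  "P ;; Q = P @ map (relabel (\<lambda>q. length P + q)) Q"

definition test :: "nat \<Rightarrow> ('s::alphabet option \<Rightarrow> bool) \<Rightarrow> nat \<Rightarrow> nat \<Rightarrow> 's instr" where
  "test k T p q = Act k (\<lambda>a. (sym a, Stay, if T a then p else q))"

text \<open>State 0 is the test, \<open>P\<close> starts at 1 and \<open>Q\<close> comes after it;
  \<open>f\<close> makes the exit of \<open>P\<close> jump over \<open>Q\<close>. Writing the branch
  target as \<open>f 0\<close> covers an empty \<open>P\<close>, whose start is its exit.\<close>

definition cond ::
  "nat \<Rightarrow> ('s::alphabet option \<Rightarrow> bool) \<Rightarrow> 's machine \<Rightarrow> 's machine \<Rightarrow> 's machine" where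
  "cond k T P Q =
    (let f = (\<lambda>q. if q = length P then Suc (length P + length Q) else Suc q);
         g = (\<lambda>q. Suc (length P + q))
     in test k T (f 0) (g 0) # map (relabel f) P @ map (relabel g) Q)"

definition loop :: "nat \<Rightarrow> ('s::alphabet option \<Rightarrow> bool) \<Rightarrow> 's machine \<Rightarrow> 's machine" where
  "loop k T P =
    (let f = (\<lambda>q. if q = length P then 0 else Suc q)
     in test k T (f 0) (Suc (length P)) # map (relabel f) P)"

lemma exec_Nil: "exec R [] c c"
  by (simp add: exec_def)

lemma exec_wr: "exec R (wr k s) c (c(k := put s (c k)))"
  unfolding exec_def wr_def by (rule reach_step1) (simp add: act_tape_Stay)

lemma exec_mv: "exec R (mv k d) c (c(k := shift d (c k)))"
  unfolding exec_def mv_def by (rule reach_step1) (simp add: shift_def sym_eq_content)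

lemma exec_seq:
  assumes "exec R P c c'" "exec R Q c' c''"
  shows "exec R (P ;; Q) c c''"
proof -
  have "reach R (P ;; Q) (0, c) (length P, c')"
    using assms(1) unfolding exec_def
    by (rule reach_embed[where f = "\<lambda>q. q"]) (simp add: seq_def nth_append)
  moreover have "reach R (P ;; Q) (length P + 0, c') (length P + length Q, c'')"
    using assms(2) unfolding exec_def
    by (rule reach_embed[where f = "\<lambda>q. length P + q"]) (simp add: seq_def nth_append)
  ultimately show ?thesis
    unfolding exec_def by (auto simp: seq_def intro: reach_trans)
qed

lemma step_test:
  "step R (test k T p q # M) (0, c) = (if T (c k 0) then p else q, c(k := fill (c k)))"
  by (simp add: test_def act_tape_Stay fill_def sym_eq_content)

lemma exec_cond:
  assumes "exec R (if T (c k 0) then P else Q) (c(k := fill (c k))) c'"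
  shows "exec R (cond k T P Q) c c'"
proof -
  define f g where "f = (\<lambda>q. if q = length P then Suc (length P + length Q) else Suc q)"
    and "g = (\<lambda>q. Suc (length P + q))"
  have M: "cond k T P Q = test k T (f 0) (g 0) # map (relabel f) P @ map (relabel g) Q"
    by (simp add: cond_def f_def g_def)
  have first: "reach R (cond k T P Q) (0, c) (if T (c k 0) then f 0 else g 0, c(k := fill (c k)))"
    by (rule reach_step1) (simp only: M step_test)
  have second: "reach R (cond k T P Q) (if T (c k 0) then f 0 else g 0, c(k := fill (c k)))
     (Suc (length P + length Q), c')"
  proof (cases "T (c k 0)")
    case True
    have "reach R (cond k T P Q) (f 0, c(k := fill (c k))) (f (length P), c')"
      by (rule reach_embed[of R P _ _ _ _ f])
        (use assms True in \<open>auto simp: exec_def M f_def nth_append\<close>)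
    then show ?thesis using True by (simp add: f_def)
  next
    case False
    have "reach R (cond k T P Q) (g 0, c(k := fill (c k))) (g (length Q), c')"
      by (rule reach_embed[of R Q _ _ _ _ g])
        (use assms False in \<open>auto simp: exec_def M g_def nth_append\<close>)
    then show ?thesis using False by (simp add: g_def)
  qed
  show ?thesis
    unfolding exec_def using reach_trans[OF first second] by (simp add: M)
qed

lemma exec_loop_end:
  assumes "\<not> T (c k 0)"
  shows "exec R (loop k T P) c (c(k := fill (c k)))"
  unfolding exec_def
  by (rule reach_step1) (use assms in \<open>simp add: loop_def step_test Let_def del: step.simps\<close>)

lemma exec_loop_step:
  assumes "T (c k 0)" "exec R P (c(k := fill (c k))) c'" "exec R (loop k T P) c' c''"
  shows "exec R (loop k T P) c c''"
proof -
  define f where "f = (\<lambda>q. if q = length P then 0 else Suc q)"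
  have M: "loop k T P = test k T (f 0) (Suc (length P)) # map (relabel f) P"
    by (simp add: loop_def f_def)
  have "reach R (loop k T P) (0, c) (f 0, c(k := fill (c k)))"
    by (rule reach_step1) (use assms(1) in \<open>simp only: M step_test if_True\<close>)
  moreover have "reach R (loop k T P) (f 0, c(k := fill (c k))) (f (length P), c')"
    by (rule reach_embed[of R P _ _ _ _ f])
      (use assms(2) in \<open>auto simp: exec_def M f_def\<close>)
  ultimately show ?thesis
    using assms(3) unfolding exec_def by (auto simp: f_def intro: reach_trans)
qed

fun switch_list :: "nat \<Rightarrow> 's::alphabet list \<Rightarrow> ('s \<Rightarrow> 's machine) \<Rightarrow> 's machine" where
  "switch_list k [] F = []"
| "switch_list k (s # ss) F = cond k (\<lambda>a. sym a = s) (F s) (switch_list k ss F)"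

definition switch :: "nat \<Rightarrow> ('s::alphabet \<Rightarrow> 's machine) \<Rightarrow> 's machine" where
  "switch k F = switch_list k (SOME ss. set ss = UNIV) F"

lemma exec_switch:
  fixes F :: "'s::alphabet \<Rightarrow> 's machine"
  assumes "exec R (F (content (c k) 0)) (c(k := fill (c k))) c'"
  shows "exec R (switch k F) c c'"
proof -
  \<comment> \<open>A failed test has already written the scanned cell, so the rest of the list
    starts from the filled tape; the claim covers both starting points.\<close>
  have "exec R (switch_list k ss F) d c'"
    if "content (c k) 0 \<in> set ss" "d = c \<or> d = c(k := fill (c k))" for ss d
    using that
  proof (induction ss arbitrary: d)
    case Nil
    then show ?case by simp
  next
    case (Cons s ss)
    have d: "d(k := fill (d k)) = c(k := fill (c k))" "sym (d k 0) = content (c k) 0"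
      using Cons.prems(2) by (auto simp: sym_eq_content)
    have "exec R (if content (c k) 0 = s then F s else switch_list k ss F) (c(k := fill (c k))) c'"
    proof (cases "content (c k) 0 = s")
      case True
      then show ?thesis using assms by simp
    next
      case False
      then have "content (c k) 0 \<in> set ss" using Cons.prems(1) by simp
      then have "exec R (switch_list k ss F) (c(k := fill (c k))) c'"
        by (intro Cons.IH disjI2 refl)
      then show ?thesis by (simp only: False if_False)
    qed
    then show ?case
      unfolding switch_list.simps by (intro exec_cond) (simp only: d)
  qed
  moreover have "\<exists>ss. set ss = (UNIV :: 's set)"
    by (rule finite_list) simp
  then have "set (SOME ss. set ss = (UNIV :: 's set)) = UNIV"
    by (rule someI_ex)
  ultimately show ?thesis by (simp add: switch_def)
qed

section \<open>Written segments\<close>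

text \<open>During a run the head may stand one cell outside of the written interval, hence the
  bounds 1 and -1. Unlike \<open>presents\<close>, this is preserved by every step.\<close>

definition seg :: "'s mtape \<Rightarrow> bool" where
  "seg t \<longleftrightarrow> (\<exists>l r. l \<le> r \<and> l \<le> 1 \<and> -1 \<le> r \<and> {i. t i \<noteq> None} = {l..r})"

lemma presents_iff: "presents t g \<longleftrightarrow> seg t \<and> t 0 \<noteq> None \<and> content t = g"
proof
  assume "presents t g"
  then obtain l r where lr: "l \<le> 0" "0 \<le> r" "{i. t i \<noteq> None} = {l..r}" "content t = g"
    by (auto simp: presents_def)
  have "seg t" unfolding seg_def using lr by (intro exI[of _ l] exI[of _ r]) auto
  moreover have "0 \<in> {i. t i \<noteq> None}" using lr by simp
  ultimately show "seg t \<and> t 0 \<noteq> None \<and> content t = g" using lr by simp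
next
  assume r: "seg t \<and> t 0 \<noteq> None \<and> content t = g"
  then obtain l r where lr: "{i. t i \<noteq> None} = {l..r}" by (auto simp: seg_def)
  then have "0 \<in> {l..r}" using r by blast
  then show "presents t g" using r lr unfolding presents_def by auto
qed

text \<open>A head inside or next to the interval extends it without a gap when it writes, and
  moving by at most one cell keeps it inside or adjacent.\<close>

lemma seg_act:
  assumes "seg t"
  shows "seg (act_tape s d t)"
proof -
  obtain l r where lr: "l \<le> r" "l \<le> 1" "-1 \<le> r" and T: "{i. t i \<noteq> None} = {l..r}"
    using assms by (auto simp: seg_def)
  have mem: "t i \<noteq> None \<longleftrightarrow> l \<le> i \<and> i \<le> r" for i
    using T by (metis (mono_tags, lifting) atLeastAtMost_iff mem_Collect_eq)
  have "offset d = 0 \<or> offset d = 1 \<or> offset d = - 1" by (cases d) auto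
  then have "{i. act_tape s d t i \<noteq> None} = {min l 0 - offset d..max r 0 - offset d}"
    using lr mem by (auto simp: act_tape_def min_def max_def split: if_splits)
  then show ?thesis
    unfolding seg_def using lr \<open>offset d = 0 \<or> offset d = 1 \<or> offset d = - 1\<close>
    by (intro exI[of _ "min l 0 - offset d"] exI[of _ "max r 0 - offset d"]) auto
qed

lemma seg_put: "seg t \<Longrightarrow> seg (put s t)"
  using seg_act[of t s Stay] by (simp add: act_tape_Stay)

lemma seg_fill: "seg t \<Longrightarrow> seg (fill t)"
  by (simp add: fill_def seg_put)

lemma seg_shift: "seg t \<Longrightarrow> seg (shift d t)"
  by (simp add: shift_def seg_act)

lemma presents_fill: "seg t \<Longrightarrow> content t = g \<Longrightarrow> presents (fill t) g"
  by (simp add: presents_iff seg_fill)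

lemma seg_between:
  assumes "seg t" "t i \<noteq> None" "t k \<noteq> None" "i \<le> j" "j \<le> k"
  shows "t j \<noteq> None"
proof -
  obtain l r where T: "{i. t i \<noteq> None} = {l..r}"
    using assms by (auto simp: seg_def)
  have "i \<in> {l..r}" "k \<in> {l..r}" using assms T by blast+
  then have "j \<in> {l..r}" using assms by auto
  then show ?thesis using T by blast
qed

lemma seg_bounded:
  assumes "seg t" "\<delta> = 1 \<or> \<delta> = - 1"
  shows "\<exists>N. \<forall>i. int N \<le> \<delta> * i \<longrightarrow> t i = None"
proof -
  obtain l r where T: "{i. t i \<noteq> None} = {l..r}"
    using assms by (auto simp: seg_def)
  have "t i = None" if "int (nat (\<bar>l\<bar> + \<bar>r\<bar> + 1)) \<le> \<delta> * i" for i
  proof -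
    have "i \<notin> {l..r}" using that assms(2) by auto
    then show ?thesis using T by blast
  qed
  then show ?thesis by blast
qed

lemma seg_step: "step R M (q, c) = (q', c') \<Longrightarrow> seg (c k) \<Longrightarrow> seg (c' k)"
  by (auto simp: seg_act split: if_splits instr.splits prod.splits)

lemma seg_reach:
  assumes "reach R M (q, c) (q', c')" "seg (c k)"
  shows "seg (c' k)"
proof -
  have "reach R M s s' \<Longrightarrow> seg (snd s k) \<Longrightarrow> seg (snd s' k)" for s s'
  proof (induction rule: reach_induct)
    case (step s)
    then show ?case using seg_step[of R M "fst s" "snd s" "fst (step R M s)" "snd (step R M s)" k]
      by (simp del: step.simps)
  qed simp
  from this[OF assms(1)] assms(2) show ?thesis by simp
qed

lemma seg_exec: "exec R P c c' \<Longrightarrow> seg (c k) \<Longrightarrow> seg (c' k)"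
  unfolding exec_def by (rule seg_reach)

section \<open>Loops that traverse a tape\<close>

text \<open>The written interval is finite, so a bound on the written cells ahead drops with every
  round. The anchor, a written cell at or behind the head, and contiguity show that an unwritten
  scanned cell is the end of the tape in direction \<open>\<delta>\<close>. The body is constrained
  only ahead of the head, since it may rewrite the cell that it leaves. The last test fills the cell
  at which it stops; \<open>c'\<close> is the state before that.\<close>

lemma exec_pass:
  fixes I :: "(nat \<Rightarrow> 's::alphabet mtape) \<Rightarrow> bool"
  assumes \<delta>: "\<delta> = 1 \<or> \<delta> = - 1"
    and seg: "\<And>c. I c \<Longrightarrow> seg (c k)"
    and anchor: "\<And>c. I c \<Longrightarrow> \<exists>i. \<delta> * i \<le> 0 \<and> c k i \<noteq> None"
    and step: "\<And>c. I c \<Longrightarrow> c k 0 \<noteq> None \<Longrightarrow>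
      \<exists>c'. exec R P c c' \<and> I c' \<and> (\<forall>i. 0 \<le> \<delta> * i \<longrightarrow> c' k i = c k (i + \<delta>))"
    and "I c"
  obtains c' where "exec R (loop k (\<lambda>a. a \<noteq> None) P) c (c'(k := fill (c' k)))" "I c'"
    "\<And>i. 0 \<le> \<delta> * i \<Longrightarrow> c' k i = None"
proof -
  define T :: "'s option \<Rightarrow> bool" where "T = (\<lambda>a. a \<noteq> None)"
  obtain N where "\<forall>i. int N \<le> \<delta> * i \<longrightarrow> c k i = None"
    using seg_bounded[OF seg[OF \<open>I c\<close>] \<delta>] by blast
  then have "\<exists>c' e. exec R (loop k T P) c e \<and> e = c'(k := fill (c' k)) \<and> I c' \<and>
    (\<forall>i. 0 \<le> \<delta> * i \<longrightarrow> c' k i = None)"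
    using \<open>I c\<close>
  proof (induction N arbitrary: c)
    case 0
    then have "exec R (loop k T P) c (c(k := fill (c k)))"
      by (intro exec_loop_end) (simp add: T_def)
    moreover have "\<forall>i. 0 \<le> \<delta> * i \<longrightarrow> c k i = None" using 0 by simp
    ultimately show ?case using 0(2) by (intro exI conjI) (rule refl | assumption)+
  next
    case (Suc N)
    show ?case
    proof (cases "c k 0 = None")
      case True
      obtain i where i: "\<delta> * i \<le> 0" "c k i \<noteq> None" using anchor[OF Suc.prems(2)] by blast
      have "c k j = None" if "0 \<le> \<delta> * j" for j
      proof (rule ccontr)
        assume j: "c k j \<noteq> None"
        have "(i \<le> 0 \<and> 0 \<le> j) \<or> (j \<le> 0 \<and> 0 \<le> i)" using i(1) that \<delta> by auto
        then have "c k 0 \<noteq> None"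
          using seg_between[OF seg[OF Suc.prems(2)]] i(2) j by blast
        with True show False by simp
      qed
      then have "\<forall>i. 0 \<le> \<delta> * i \<longrightarrow> c k i = None" by blast
      moreover have "exec R (loop k T P) c (c(k := fill (c k)))"
        by (rule exec_loop_end) (simp add: T_def True)
      ultimately show ?thesis using Suc.prems(2) by (intro exI conjI) (rule refl | assumption)+
    next
      case False
      obtain c1 where c1: "exec R P c c1" "I c1" "\<forall>i. 0 \<le> \<delta> * i \<longrightarrow> c1 k i = c k (i + \<delta>)"
        using step[OF Suc.prems(2) False] by blast
      have "c1 k i = None" if "int N \<le> \<delta> * i" for i
      proof -
        have "0 \<le> \<delta> * i" "int (Suc N) \<le> \<delta> * (i + \<delta>)" using that \<delta> by auto
        then show ?thesis using c1(3) Suc.prems(1) by simp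
      qed
      then obtain c' e where c': "exec R (loop k T P) c1 e" "e = c'(k := fill (c' k))" "I c'"
        "\<forall>i. 0 \<le> \<delta> * i \<longrightarrow> c' k i = None"
        using Suc.IH[of c1] c1(2) by blast
      have "c(k := fill (c k)) = c" using False by simp
      then have "exec R P (c(k := fill (c k))) c1" using c1(1) by (simp only:)
      moreover have "T (c k 0)" using False by (simp add: T_def)
      ultimately have "exec R (loop k T P) c e"
        using exec_loop_step c'(1) by blast
      with c'(2-) show ?thesis by blast
    qed
  qed
  then show ?thesis using that unfolding T_def by blast
qed

text \<open>For loops whose number of rounds is known in advance; \<open>n\<close> counts the rounds
  that remain.\<close>

lemma exec_countdown:
  assumes fill: "\<And>n c. I n c \<Longrightarrow> I n (c(k := fill (c k)))"
    and step: "\<And>n c. I (Suc n) c \<Longrightarrow> T (c k 0) \<and> (\<exists>c'. exec R P c c' \<and> I n c')"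
    and stop: "\<And>c. I 0 c \<Longrightarrow> \<not> T (c k 0)"
    and "I n c"
  shows "\<exists>c'. exec R (loop k T P) c c' \<and> I 0 c'"
  using \<open>I n c\<close>
proof (induction n arbitrary: c)
  case 0
  then show ?case using exec_loop_end[of T c k R P] fill stop by blast
next
  case (Suc n)
  obtain c1 where c1: "exec R P (c(k := fill (c k))) c1" "I n c1"
    using step[OF fill[OF Suc.prems]] by blast
  obtain c' where c': "exec R (loop k T P) c1 c'" "I 0 c'"
    using Suc.IH[OF c1(2)] by blast
  have "T (c k 0)" using step[OF Suc.prems] by blast
  from exec_loop_step[of T, OF this c1(1) c'(1)] c'(2) show ?case by blast
qed

section \<open>Visiting two tapes in lockstep\<close>

lemma shift_apply:
  "shift d t i = (if i + offset d = 0 then Some (content t 0) else t (i + offset d))"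
  by (auto simp: shift_def act_tape_def)

lemma put_put [simp]: "put s (put s' t) = put s t"
  by (simp add: put_def)

lemma put_fill [simp]: "put s (fill t) = put s t"
  by (simp add: fill_def)

lemma put_apply: "put s t i = (if i = 0 then Some s else t i)"
  by (simp add: put_def)

(* The heads of the tapes a, b and m move together.  Tape m carries a mark at the origin, by which
   the heads find their way back. *)

locale lockstep =
  fixes R :: "'s::alphabet tape set"
    and mark :: 's
    and a b m f :: nat
    and u :: "'s \<Rightarrow> 's \<Rightarrow> 's"
    and w :: "'s \<Rightarrow> 's \<Rightarrow> bool"
    and \<alpha> \<beta> :: "int \<Rightarrow> 's"
    and c0 :: "nat \<Rightarrow> 's mtape"
  assumes distinct: "a \<noteq> b" "a \<noteq> m" "a \<noteq> f" "b \<noteq> m" "b \<noteq> f" "m \<noteq> f"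
    and mark: "mark \<noteq> blank"
    and u_blank: "u blank blank = blank"
    and w_blank: "\<not> w blank blank"
begin

definition moves :: "move \<Rightarrow> 's machine" where
  "moves d = mv a d ;; mv b d ;; mv m d"

text \<open>\<open>u\<close> gives the new symbol on \<open>a\<close>, and \<open>w\<close> raises a
  flag on tape \<open>f\<close>, whose head stays put. Comparison and copying are both
  instances.\<close>

definition visit :: "'s machine" where
  "visit = switch a (\<lambda>s. switch b (\<lambda>t. wr a (u s t) ;; (if w s t then wr f mark else [])))"

text \<open>The visiting pass first runs to the mark: at the left end the cell of \<open>a\<close>
  under the head may be unwritten, and a test for unwritten cells would stop there. From the origin
  rightwards an unwritten cell does mean the end of the tape.\<close>

definition sweep :: "'s machine" where
  "sweep =
     loop a (\<lambda>v. v \<noteq> None) (moves Left) ;;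
     loop b (\<lambda>v. v \<noteq> None) (moves Left) ;;
     loop m (\<lambda>v. sym v \<noteq> mark) (visit ;; moves Right) ;;
     loop a (\<lambda>v. v \<noteq> None) (visit ;; moves Right) ;;
     loop b (\<lambda>v. v \<noteq> None) (visit ;; moves Right) ;;
     loop m (\<lambda>v. sym v \<noteq> mark) (moves Left)"

text \<open>\<open>p\<close> is the position of the heads relative to the start, so the origin is
  cell \<open>- p\<close> as seen from the head; \<open>\<gamma>\<close> and \<open>\<beta>\<close>
  use fixed coordinates. The origin is kept written because it is the anchor for
  \<open>exec_pass\<close>.\<close>

definition at :: "(int \<Rightarrow> 's) \<Rightarrow> 's mtape \<Rightarrow> int \<Rightarrow> (nat \<Rightarrow> 's mtape) \<Rightarrow> bool" where
  "at \<gamma> F p c \<longleftrightarrow> seg (c a) \<and> seg (c b) \<and> seg (c m) \<and> c a (- p) \<noteq> None \<and> c b (- p) \<noteq> None \<and>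
    (\<forall>i. content (c a) i = \<gamma> (i + p)) \<and> (\<forall>i. content (c b) i = \<beta> (i + p)) \<and>
    (\<forall>i. content (c m) i = (if i + p = 0 then mark else blank)) \<and>
    c f = F \<and> (\<forall>k. k \<notin> {a, b, m, f} \<longrightarrow> c k = c0 k)"

lemma exec_moves:
  assumes "at \<gamma> F p c"
  shows "\<exists>c'. exec R (moves d) c c' \<and> at \<gamma> F (p + offset d) c' \<and>
    c' a = shift d (c a) \<and> c' b = shift d (c b)"
proof -
  let ?c = "c(a := shift d (c a), b := shift d (c b), m := shift d (c m))"
  have 2: "exec R (mv b d) (c(a := shift d (c a))) (c(a := shift d (c a), b := shift d (c b)))"
    using exec_mv[of R b d "c(a := shift d (c a))"] distinct by simp
  have 3: "exec R (mv m d) (c(a := shift d (c a), b := shift d (c b))) ?c"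
    using exec_mv[of R m d "c(a := shift d (c a), b := shift d (c b))"] distinct by simp
  have "exec R (moves d) c ?c"
    unfolding moves_def by (intro exec_seq[OF exec_mv] exec_seq[OF 2] 3)
  moreover have "at \<gamma> F (p + offset d) ?c"
  proof -
    have shift_p: "shift d t (- p - offset d) \<noteq> None" if "t (- p) \<noteq> None" for t :: "'s mtape"
      using that by (simp add: shift_apply)
    have p: "i + (p + offset d) = i + offset d + p" for i by simp
    show ?thesis
      using assms distinct shift_p[of "c a"] shift_p[of "c b"] unfolding at_def
      by (simp add: seg_shift content_shift p)
  qed
  ultimately show ?thesis using distinct by (intro exI[of _ ?c]) simp
qed

lemma exec_visit:
  assumes "at \<gamma> F p c"
  shows "\<exists>c'. exec R visit c c' \<and>
    at (\<gamma>(p := u (\<gamma> p) (\<beta> p))) (if w (\<gamma> p) (\<beta> p) then put mark F else F) p c' \<and>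
    (\<forall>i. i \<noteq> 0 \<longrightarrow> c' a i = c a i \<and> c' b i = c b i)"
proof -
  let ?c = "c(a := put (u (\<gamma> p) (\<beta> p)) (c a), b := fill (c b),
    f := if w (\<gamma> p) (\<beta> p) then put mark (c f) else c f)"
  have s: "content (c a) 0 = \<gamma> p" "content (c b) 0 = \<beta> p"
    using assms by (simp_all add: at_def)
  let ?d = "c(a := fill (c a), b := fill (c b))"
  let ?e = "?d(a := put (u (\<gamma> p) (\<beta> p)) (?d a))"
  have e: "?c = (if w (\<gamma> p) (\<beta> p) then ?e(f := put mark (?e f)) else ?e)"
    using distinct by (auto simp: fun_eq_iff)
  have "exec R (if w (\<gamma> p) (\<beta> p) then wr f mark else []) ?e ?c"
    unfolding e using exec_wr[of R f mark ?e] exec_Nil[of R ?e] by (simp only: split: if_split) blast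
  then have "exec R (wr a (u (\<gamma> p) (\<beta> p)) ;; (if w (\<gamma> p) (\<beta> p) then wr f mark else [])) ?d ?c"
    by (rule exec_seq[OF exec_wr])
  then have switch_b: "exec R (switch b (\<lambda>t. wr a (u (\<gamma> p) t) ;; (if w (\<gamma> p) t then wr f mark else [])))
      (c(a := fill (c a))) ?c"
    by (intro exec_switch) (use distinct s in simp)
  have "exec R visit c ?c"
    unfolding visit_def by (rule exec_switch) (unfold s, rule switch_b)
  moreover have "at (\<gamma>(p := u (\<gamma> p) (\<beta> p))) (if w (\<gamma> p) (\<beta> p) then put mark F else F) p ?c"
  proof -
    have "(\<gamma>(p := z)) (i + p) = (if i = 0 then z else \<gamma> (i + p))" for i z by simp
    then show ?thesis
      using assms distinct unfolding at_def
      by (simp add: seg_put seg_fill fill_neq_None content_put put_apply)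
  qed
  moreover have "\<forall>i. i \<noteq> 0 \<longrightarrow> ?c a i = c a i \<and> ?c b i = c b i"
    using distinct by (auto simp: put_apply fill_def)
  ultimately show ?thesis by blast
qed

lemma at_fill:
  assumes "at \<gamma> F p c" "k \<in> {a, b, m}"
  shows "at \<gamma> F p (c(k := fill (c k)))"
proof -
  have "k = a \<or> k = b \<or> k = m" using assms(2) by blast
  then show ?thesis
    using assms(1) distinct unfolding at_def
    by (elim disjE) (simp_all add: seg_fill fill_neq_None del: not_None_eq)
qed

text \<open>Outside of the visited window both tapes are blank, and there a visit would change
  nothing by \<open>u_blank\<close> and \<open>w_blank\<close>. Hence the effect is that of visiting
  every cell.\<close>

lemma exec_sweep:
  assumes "presents (c0 a) \<alpha>" "presents (c0 b) \<beta>"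
    and "presents (c0 m) (\<lambda>i. if i = 0 then mark else blank)"
  shows "\<exists>c'. exec R sweep c0 c' \<and> presents (c' a) (\<lambda>i. u (\<alpha> i) (\<beta> i)) \<and> presents (c' b) \<beta> \<and>
    presents (c' m) (\<lambda>i. if i = 0 then mark else blank) \<and>
    c' f = (if \<exists>i. w (\<alpha> i) (\<beta> i) then put mark (c0 f) else c0 f) \<and>
    (\<forall>k. k \<notin> {a, b, m, f} \<longrightarrow> c' k = c0 k)"
proof -
  have c0: "at \<alpha> (c0 f) 0 c0"
    using assms by (auto simp: at_def presents_iff)
  \<comment> \<open>Applied to \<open>a\<close> and then to \<open>b\<close>; the origin is at or to
    the right of the heads and serves as the anchor.\<close>
  have left: "\<exists>c' p'. exec R (loop k (\<lambda>v. v \<noteq> None) (moves Left)) c c' \<and> p' \<le> p \<and>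
      at \<alpha> (c0 f) p' c' \<and> (\<forall>i\<le>0. content (c' k) i = blank)"
    if p: "at \<alpha> (c0 f) p c" "p \<le> 0" and k: "k = a \<or> k = b" for c p k
  proof -
    define I where "I = (\<lambda>c. \<exists>p'\<le>p. at \<alpha> (c0 f) p' c)"
    have 1: "seg (c k)" if "I c" for c
        using that k by (auto simp: I_def at_def)
    have 2: "\<exists>i. - 1 * i \<le> 0 \<and> c k i \<noteq> None" if c: "I c" for c
      proof -
        obtain p' where "p' \<le> p" "at \<alpha> (c0 f) p' c" using c by (auto simp: I_def)
        then show ?thesis using k p(2) by (intro exI[of _ "- p'"]) (auto simp: at_def)
      qed
    have 3: "\<exists>c'. exec R (moves Left) c c' \<and> I c' \<and> (\<forall>i. 0 \<le> - 1 * i \<longrightarrow> c' k i = c k (i + - 1))"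
        if c: "I c" for c
      proof -
        obtain p' where p': "p' \<le> p" "at \<alpha> (c0 f) p' c" using c by (auto simp: I_def)
        obtain c' where c': "exec R (moves Left) c c'" "at \<alpha> (c0 f) (p' + offset Left) c'"
          "c' a = shift Left (c a)" "c' b = shift Left (c b)"
          using exec_moves[OF p'(2)] by blast
        then have "I c'" unfolding I_def using p'(1) by (intro exI[of _ "p' - 1"]) simp
        then show ?thesis using c' k by (intro exI[of _ c']) (auto simp: shift_apply)
      qed
    have "I c" using p by (auto simp: I_def)
    then obtain c' where
      c': "exec R (loop k (\<lambda>v. v \<noteq> None) (moves Left)) c (c'(k := fill (c' k)))"
      "I c'" "\<And>i. 0 \<le> - 1 * i \<Longrightarrow> c' k i = None"
      using exec_pass[of "- 1" I k R "moves Left" c] 1 2 3 by blast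
    from c'(2) obtain p' where "p' \<le> p" "at \<alpha> (c0 f) p' c'" by (auto simp: I_def)
    moreover have "content (c' k) i = blank" if "i \<le> 0" for i
      using that c'(3)[of i] by (simp add: content_def)
    ultimately show ?thesis
      using c'(1) k at_fill[of \<alpha> "c0 f" p' c' k]
      by (intro exI[of _ "c'(k := fill (c' k))"] exI[of _ p']) auto
  qed
  obtain c1 p1 where c1: "exec R (loop a (\<lambda>v. v \<noteq> None) (moves Left)) c0 c1"
    "p1 \<le> 0" "at \<alpha> (c0 f) p1 c1" "\<forall>i\<le>0. content (c1 a) i = blank"
    using left[OF c0, of a] by auto
  obtain c2 l where c2: "exec R (loop b (\<lambda>v. v \<noteq> None) (moves Left)) c1 c2"
    "l \<le> p1" "at \<alpha> (c0 f) l c2" "\<forall>i\<le>0. content (c2 b) i = blank"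
    using left[OF c1(3,2), of b] by auto
  have \<alpha>_left: "\<alpha> i = blank" if "i \<le> l" for i
    using c1(3,4) c2(2) that unfolding at_def
    by (metis add.commute diff_add_cancel diff_le_0_iff_le order_trans)
  have \<beta>_left: "\<beta> i = blank" if "i \<le> l" for i
    using c2(3,4) that unfolding at_def
    by (metis add.commute diff_add_cancel diff_le_0_iff_le)

  \<comment> \<open>\<open>A p\<close> and \<open>F p\<close> are what tapes \<open>a\<close> and
    \<open>f\<close> hold once exactly the cells from \<open>l\<close> to \<open>p - 1\<close> have
    been visited.\<close>
  define A where "A p i = (if l \<le> i \<and> i < p then u (\<alpha> i) (\<beta> i) else \<alpha> i)" for p i
  define F where "F p = (if \<exists>i. l \<le> i \<and> i < p \<and> w (\<alpha> i) (\<beta> i) then put mark (c0 f) else c0 f)" for p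
  have A_step: "A (p + 1) = (A p)(p := u (A p p) (\<beta> p))" if "l \<le> p" for p
    using that by (auto simp: A_def fun_eq_iff)
  have F_step: "F (p + 1) = (if w (A p p) (\<beta> p) then put mark (F p) else F p)" if "l \<le> p" for p
  proof -
    have "(\<exists>i. l \<le> i \<and> i < p + 1 \<and> w (\<alpha> i) (\<beta> i)) \<longleftrightarrow>
      w (\<alpha> p) (\<beta> p) \<or> (\<exists>i. l \<le> i \<and> i < p \<and> w (\<alpha> i) (\<beta> i))"
      using that by (metis add1_zle_eq linorder_not_less nless_le order_refl zle_add1_eq_le)
    moreover have "A p p = \<alpha> p" by (simp add: A_def)
    ultimately show ?thesis by (auto simp: F_def)
  qed
  \<comment> \<open>A visit changes only the scanned cells, which the move then leaves behind; the
    cells ahead are merely shifted, as \<open>exec_pass\<close> demands.\<close>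
  have right_step: "\<exists>c'. exec R (visit ;; moves Right) c c' \<and> at (A (p + 1)) (F (p + 1)) (p + 1) c' \<and>
      (\<forall>i\<ge>0. c' a i = c a (i + 1) \<and> c' b i = c b (i + 1))"
    if p: "at (A p) (F p) p c" "l \<le> p" for p c
  proof -
    obtain c1 where c1: "exec R visit c c1" "at (A (p + 1)) (F (p + 1)) p c1"
      "\<forall>i. i \<noteq> 0 \<longrightarrow> c1 a i = c a i \<and> c1 b i = c b i"
      using exec_visit[OF p(1)] A_step[OF p(2)] F_step[OF p(2)] by auto
    obtain c' where c': "exec R (moves Right) c1 c'"
      "at (A (p + 1)) (F (p + 1)) (p + offset Right) c'"
      "c' a = shift Right (c1 a)" "c' b = shift Right (c1 b)"
      using exec_moves[OF c1(2)] by blast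
    show ?thesis
      using exec_seq[OF c1(1) c'(1)] c'(2-) c1(3) by (intro exI[of _ c']) (auto simp: shift_apply)
  qed
  have right: "\<exists>c' p'. exec R (loop k (\<lambda>v. v \<noteq> None) (visit ;; moves Right)) c c' \<and> p \<le> p' \<and>
      at (A p') (F p') p' c' \<and> (\<forall>i\<ge>0. content (c' k) i = blank)"
    if p: "at (A p) (F p) p c" "0 \<le> p" and k: "k = a \<or> k = b" for c p k
  proof -
    define I where "I = (\<lambda>c. \<exists>p'\<ge>p. at (A p') (F p') p' c)"
    have 1: "seg (c k)" if "I c" for c
        using that k by (auto simp: I_def at_def)
    have 2: "\<exists>i. 1 * i \<le> 0 \<and> c k i \<noteq> None" if c: "I c" for c
      proof -
        obtain p' where "p \<le> p'" "at (A p') (F p') p' c" using c by (auto simp: I_def)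
        then show ?thesis using k p(2) by (intro exI[of _ "- p'"]) (auto simp: at_def)
      qed
    have 3: "\<exists>c'. exec R (visit ;; moves Right) c c' \<and> I c' \<and>
          (\<forall>i. 0 \<le> 1 * i \<longrightarrow> c' k i = c k (i + 1))"
        if c: "I c" for c
      proof -
        obtain p' where p': "p \<le> p'" "at (A p') (F p') p' c" using c by (auto simp: I_def)
        moreover have "l \<le> p'" using p' p(2) c1(2) c2(2) by linarith
        ultimately obtain c' where c': "exec R (visit ;; moves Right) c c'"
          "at (A (p' + 1)) (F (p' + 1)) (p' + 1) c'"
          "\<forall>i\<ge>0. c' a i = c a (i + 1) \<and> c' b i = c b (i + 1)"
          using right_step by blast
        then have "I c'" unfolding I_def using p'(1) by (intro exI[of _ "p' + 1"]) simp
        then show ?thesis using c' k by (intro exI[of _ c']) auto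
      qed
    have "I c" using p by (auto simp: I_def)
    then obtain c' where
      c': "exec R (loop k (\<lambda>v. v \<noteq> None) (visit ;; moves Right)) c (c'(k := fill (c' k)))"
      "I c'" "\<And>i. 0 \<le> 1 * i \<Longrightarrow> c' k i = None"
      using exec_pass[of 1 I k R "visit ;; moves Right" c] 1 2 3 by blast
    from c'(2) obtain p' where "p \<le> p'" "at (A p') (F p') p' c'" by (auto simp: I_def)
    moreover have "content (c' k) i = blank" if "0 \<le> i" for i
      using that c'(3)[of i] by (simp add: content_def)
    ultimately show ?thesis
      using c'(1) k at_fill[of "A p'" "F p'" p' c' k]
      by (intro exI[of _ "c'(k := fill (c' k))"] exI[of _ p']) auto
  qed

  have m_mark: "sym (c m 0) = mark \<longleftrightarrow> p = 0" if "at \<gamma> F p c" for \<gamma> F p c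
    using that mark by (auto simp: at_def sym_eq_content)
  have "at (A l) (F l) l c2"
  proof -
    have "A l = \<alpha>" "F l = c0 f" by (auto simp: A_def F_def fun_eq_iff)
    then show ?thesis using c2(3) by simp
  qed
  then have "\<exists>c'. exec R (loop m (\<lambda>v. sym v \<noteq> mark) (visit ;; moves Right)) c2 c' \<and>
      (at (A (- int 0)) (F (- int 0)) (- int 0) c' \<and> 0 \<le> nat (- l))"
  \<comment> \<open>The counter is the distance to the mark; its bound says that the heads are not
    left of \<open>l\<close>, which \<open>right_step\<close> requires.\<close>
  proof (intro exec_countdown[where I = "\<lambda>n c. at (A (- int n)) (F (- int n)) (- int n) c \<and> n \<le> nat (- l)"
        and n = "nat (- l)"])
    fix n c
    assume *: "at (A (- int (Suc n))) (F (- int (Suc n))) (- int (Suc n)) c \<and> Suc n \<le> nat (- l)"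
    then have "l \<le> - int (Suc n)" by linarith
    from right_step[OF conjunct1[OF *] this]
    show "sym (c m 0) \<noteq> mark \<and> (\<exists>c'. exec R (visit ;; moves Right) c c' \<and>
        at (A (- int n)) (F (- int n)) (- int n) c' \<and> n \<le> nat (- l))"
      using * m_mark by fastforce
  qed (use at_fill m_mark c1(2) c2(2) in auto)
  then obtain c3 where c3: "exec R (loop m (\<lambda>v. sym v \<noteq> mark) (visit ;; moves Right)) c2 c3"
    "at (A 0) (F 0) 0 c3" by auto
  obtain c4 p4 where c4: "exec R (loop a (\<lambda>v. v \<noteq> None) (visit ;; moves Right)) c3 c4"
    "0 \<le> p4" "at (A p4) (F p4) p4 c4" "\<forall>i\<ge>0. content (c4 a) i = blank"
    using right[OF c3(2), of a] by auto
  obtain c5 r where c5: "exec R (loop b (\<lambda>v. v \<noteq> None) (visit ;; moves Right)) c4 c5"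
    "p4 \<le> r" "at (A r) (F r) r c5" "\<forall>i\<ge>0. content (c5 b) i = blank"
    using right[OF c4(3,2), of b] by auto
  have \<alpha>_right: "\<alpha> i = blank" if "r \<le> i" for i
  proof -
    have "content (c4 a) (i - p4) = A p4 i" using c4(3) by (simp add: at_def)
    moreover have "A p4 i = \<alpha> i" using that c5(2) by (simp add: A_def)
    ultimately show ?thesis using c4(4) that c5(2) by simp
  qed
  have \<beta>_right: "\<beta> i = blank" if "r \<le> i" for i
  proof -
    have "content (c5 b) (i - r) = \<beta> i" using c5(3) by (simp add: at_def)
    then show ?thesis using c5(4) that by simp
  qed
  have A_r: "A r = (\<lambda>i. u (\<alpha> i) (\<beta> i))"
    using \<alpha>_left \<beta>_left \<alpha>_right \<beta>_right u_blank by (auto simp: A_def fun_eq_iff)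
  have "(\<exists>i. l \<le> i \<and> i < r \<and> w (\<alpha> i) (\<beta> i)) \<longleftrightarrow> (\<exists>i. w (\<alpha> i) (\<beta> i))"
    using \<alpha>_left \<beta>_left \<alpha>_right \<beta>_right w_blank by (metis linorder_le_cases linorder_not_less)
  then have F_r: "F r = (if \<exists>i. w (\<alpha> i) (\<beta> i) then put mark (c0 f) else c0 f)"
    by (simp add: F_def)

  have "\<exists>c'. exec R (loop m (\<lambda>v. sym v \<noteq> mark) (moves Left)) c5 c' \<and> at (A r) (F r) (int 0) c'"
  proof (intro exec_countdown[where I = "\<lambda>n c. at (A r) (F r) (int n) c" and n = "nat r"])
    fix n c
    assume *: "at (A r) (F r) (int (Suc n)) c"
    from exec_moves[OF *, of Left] m_mark[OF *]
    show "sym (c m 0) \<noteq> mark \<and> (\<exists>c'. exec R (moves Left) c c' \<and> at (A r) (F r) (int n) c')"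
      by auto
  qed (use at_fill m_mark c4(2) c5(2,3) in auto)
  then obtain c6 where c6: "exec R (loop m (\<lambda>v. sym v \<noteq> mark) (moves Left)) c5 c6"
    "at (A r) (F r) 0 c6" by auto
  have "exec R sweep c0 c6"
    unfolding sweep_def
    by (intro exec_seq[OF c1(1)] exec_seq[OF c2(1)] exec_seq[OF c3(1)] exec_seq[OF c4(1)]
        exec_seq[OF c5(1)] c6(1))
  \<comment> \<open>An unwritten cell would read as blank and not as the mark.\<close>
  moreover have "c6 m 0 \<noteq> None"
    using m_mark[OF c6(2)] mark by (cases "c6 m 0") auto
  ultimately show ?thesis
    using c6(2) unfolding at_def A_r F_r
    by (intro exI[of _ c6]) (simp add: presents_iff fun_eq_iff)
qed

end

section \<open>Erasing and initialising tapes\<close>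

text \<open>If the head stands just beyond the right end of the interval, a pass to the left would
  stop at once; \<open>mv k Stay\<close> therefore writes the scanned cell first.\<close>

definition erase :: "nat \<Rightarrow> 's::alphabet machine" where
  "erase k = mv k Stay ;; loop k (\<lambda>a. a \<noteq> None) (mv k Left) ;;
     loop k (\<lambda>a. a \<noteq> None) (wr k blank ;; mv k Right)"

lemma shift_Stay: "shift Stay t = fill t"
  by (simp add: shift_def fill_def act_tape_Stay)

lemma exec_erase:
  fixes c :: "nat \<Rightarrow> 's::alphabet mtape"
  assumes "seg (c k)"
  shows "\<exists>t. exec R (erase k) c (c(k := t)) \<and> presents t (\<lambda>_. blank)"
proof -
  define I where "I = (\<lambda>d. seg (d k) \<and> (\<exists>i\<ge>0. d k i \<noteq> None) \<and> (\<forall>j. j \<noteq> k \<longrightarrow> d j = c j))"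
  have 3: "\<exists>d'. exec R (mv k Left) d d' \<and> I d' \<and> (\<forall>i. 0 \<le> - 1 * i \<longrightarrow> d' k i = d k (i + - 1))"
    if I: "I d" for d
  proof -
    obtain i where "0 \<le> i" "d k i \<noteq> None" using I by (auto simp: I_def)
    then have "shift Left (d k) (i + 1) \<noteq> None" "0 \<le> i + 1" by (simp_all add: shift_apply)
    then have "\<exists>i\<ge>0. shift Left (d k) i \<noteq> None" by blast
    then have "I (d(k := shift Left (d k)))"
      using I by (simp add: I_def seg_shift)
    then show ?thesis using exec_mv[of R k Left d]
      by (intro exI[of _ "d(k := shift Left (d k))"]) (simp add: shift_apply)
  qed
  have "\<exists>i\<ge>0. fill (c k) i \<noteq> None" by (intro exI[of _ 0]) simp
  then have "I (c(k := fill (c k)))" using assms by (simp add: I_def seg_fill)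
  then obtain d where d:
      "exec R (loop k (\<lambda>a. a \<noteq> None) (mv k Left)) (c(k := fill (c k))) (d(k := fill (d k)))"
      "I d" "\<And>i. 0 \<le> - 1 * i \<Longrightarrow> d k i = None"
    using exec_pass[of "- 1" I k R "mv k Left" "c(k := fill (c k))"] 3 by (auto simp: I_def)
  define J where "J = (\<lambda>d. seg (d k) \<and> (\<exists>i\<le>0. d k i \<noteq> None) \<and>
    (\<forall>i<0. content (d k) i = blank) \<and> (\<forall>j. j \<noteq> k \<longrightarrow> d j = c j))"
  have 4: "\<exists>d'. exec R (wr k blank ;; mv k Right) d d' \<and> J d' \<and>
      (\<forall>i. 0 \<le> 1 * i \<longrightarrow> d' k i = d k (i + 1))"
    if J: "J d" for d
  proof -
    let ?t = "shift Right (put blank (d k))"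
    have "?t (- 1) \<noteq> None" by (simp add: shift_apply)
    moreover have "content ?t i = blank" if "i < 0" for i
      using that J by (simp add: J_def content_shift content_put)
    ultimately have "J (d(k := ?t))"
      using J by (auto simp: J_def seg_shift seg_put simp del: not_None_eq intro!: exI[of _ "- 1"])
    moreover have "exec R (wr k blank ;; mv k Right) d (d(k := ?t))"
      using exec_seq[OF exec_wr exec_mv[of R k Right "d(k := put blank (d k))"]] by simp
    ultimately show ?thesis
      by (intro exI[of _ "d(k := ?t)"]) (simp add: shift_apply put_apply)
  qed
  have "content (d k) i = blank" if "i < 0" for i
    using d(3)[of i] that by (simp add: content_def)
  then have "J (d(k := fill (d k)))"
    using d(2) unfolding I_def J_def by (simp add: seg_fill) (metis fill_0 option.distinct(1) order_refl)
  then obtain e where e: "exec R (loop k (\<lambda>a. a \<noteq> None) (wr k blank ;; mv k Right)) (d(k := fill (d k)))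
       (e(k := fill (e k)))" "J e" "\<And>i. 0 \<le> 1 * i \<Longrightarrow> e k i = None"
    using exec_pass[of 1 J k R "wr k blank ;; mv k Right" "d(k := fill (d k))"] 4 by (auto simp: J_def)
  have "content (e k) i = blank" for i
    using e(2) e(3)[of i] by (cases "i < 0") (simp_all add: J_def content_def)
  then have "presents (fill (e k)) (\<lambda>_. blank)"
    using e(2) by (intro presents_fill) (auto simp: J_def)
  moreover have "e(k := fill (e k)) = c(k := fill (e k))"
    using e(2) by (auto simp: J_def)
  ultimately show ?thesis
    using exec_seq[OF exec_mv[of R k Stay c, unfolded shift_Stay] exec_seq[OF d(1) e(1)]]
    unfolding erase_def by metis
qed

lemma exec_mv_seq_mv:
  assumes "exec R P (c(k := shift d (c k))) (c(k := t))"
  shows "exec R (mv k d ;; P ;; mv k d') c (c(k := shift d' t))"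
  using exec_seq[OF exec_mv exec_seq[OF assms exec_mv[of R k d']]] by simp

text \<open>The position \<open>j\<close> is built into the program: move one cell, apply the
  program for the neighbouring position, move back.\<close>

lemma ex_write_cell:
  "\<exists>P. \<forall>c. \<exists>t. exec R P c (c(k := t)) \<and> content t = (content (c k))(j := s)"
proof (induction j rule: int_induct[of _ 0])
  case base
  show ?case
    using exec_wr content_put by (intro exI[of _ "wr k s"]) blast
next
  case (step1 j)
  then obtain P where P: "\<And>c. \<exists>t. exec R P c (c(k := t)) \<and> content t = (content (c k))(j := s)"
    by blast
  have "\<exists>t. exec R (mv k Right ;; P ;; mv k Left) c (c(k := t)) \<and>
      content t = (content (c k))(j + 1 := s)" for c
  proof -
    obtain t where t: "exec R P (c(k := shift Right (c k))) (c(k := t))"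
      "content t = (content (shift Right (c k)))(j := s)"
      using P[of "c(k := shift Right (c k))"] by auto
    have "content (shift Left t) = (content (c k))(j + 1 := s)"
      by (rule ext) (simp add: content_shift t(2))
    with exec_mv_seq_mv[OF t(1)] show ?thesis by blast
  qed
  then show ?case by blast
next
  case (step2 j)
  then obtain P where P: "\<And>c. \<exists>t. exec R P c (c(k := t)) \<and> content t = (content (c k))(j := s)"
    by blast
  have "\<exists>t. exec R (mv k Left ;; P ;; mv k Right) c (c(k := t)) \<and>
      content t = (content (c k))(j - 1 := s)" for c
  proof -
    obtain t where t: "exec R P (c(k := shift Left (c k))) (c(k := t))"
      "content t = (content (shift Left (c k)))(j := s)"
      using P[of "c(k := shift Left (c k))"] by auto
    have "content (shift Right t) = (content (c k))(j - 1 := s)"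
      by (rule ext) (simp add: content_shift t(2))
    with exec_mv_seq_mv[OF t(1)] show ?thesis by blast
  qed
  then show ?case by blast
qed

text \<open>The finitely many non-blank cells are written one by one; a final
  \<open>mv k Stay\<close> ensures the written scanned cell that \<open>presents\<close>
  demands.\<close>

lemma ex_write_tape:
  fixes \<tau> :: "'s::alphabet tape"
  shows "\<exists>P. \<forall>c. presents (c k) (\<lambda>_. blank) \<longrightarrow>
    (\<exists>t. exec R P c (c(k := t)) \<and> presents t (cell \<tau>))"
proof -
  have "\<exists>P. \<forall>c. content (c k) = (\<lambda>_. blank) \<longrightarrow> (\<exists>t. exec R P c (c(k := t)) \<and>
      content t = (\<lambda>i. if i \<in> S then cell \<tau> i else blank))" if "finite S" for S
    using that
  proof induction
    case empty
    have "exec R [] c (c(k := c k))" for c :: "nat \<Rightarrow> 's mtape" using exec_Nil[of R c] by simp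
    then show ?case by (intro exI[of _ "[]"] allI impI) (rule exI, rule conjI, assumption, simp)
  next
    case (insert j S)
    then obtain P where P: "\<And>c. content (c k) = (\<lambda>_. blank) \<Longrightarrow> \<exists>t. exec R P c (c(k := t)) \<and>
      content t = (\<lambda>i. if i \<in> S then cell \<tau> i else blank)" by blast
    obtain Q where Q: "\<And>c. \<exists>t. exec R Q c (c(k := t)) \<and>
        content t = (content (c k))(j := cell \<tau> j)"
      using ex_write_cell[of R k j "cell \<tau> j"] by blast
    have "\<exists>t. exec R (P ;; Q) c (c(k := t)) \<and>
      content t = (\<lambda>i. if i \<in> insert j S then cell \<tau> i else blank)"
      if "content (c k) = (\<lambda>_. blank)" for c
    proof -
      obtain t where t: "exec R P c (c(k := t))"
        "content t = (\<lambda>i. if i \<in> S then cell \<tau> i else blank)" using P \<open>content (c k) = _\<close> by blast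
      obtain t' where t': "exec R Q (c(k := t)) (c(k := t'))"
        "content t' = (content t)(j := cell \<tau> j)" using Q[of "c(k := t)"] by auto
      show ?thesis
        using exec_seq[OF t(1) t'(1)] t(2) t'(2) by (intro exI[of _ t']) (auto simp: fun_eq_iff)
    qed
    then show ?case by blast
  qed
  moreover have "finite {i. cell \<tau> i \<noteq> blank}" using cell[of \<tau>] by simp
  ultimately obtain P where P: "\<And>c. content (c k) = (\<lambda>_. blank) \<Longrightarrow> \<exists>t. exec R P c (c(k := t)) \<and>
      content t = (\<lambda>i. if i \<in> {i. cell \<tau> i \<noteq> blank} then cell \<tau> i else blank)" by blast
  have "\<exists>t. exec R (P ;; mv k Stay) c (c(k := t)) \<and> presents t (cell \<tau>)"
    if c: "presents (c k) (\<lambda>_. blank)" for c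
  proof -
    obtain t where t: "exec R P c (c(k := t))" "content t = cell \<tau>"
      using P[of c] c by (auto simp: presents_iff fun_eq_iff)
    have "exec R (P ;; mv k Stay) c (c(k := fill t))"
      using exec_seq[OF t(1) exec_mv[of R k Stay]] by (simp add: shift_Stay)
    moreover have "seg t" using seg_exec[OF t(1), of k] c by (simp add: presents_iff)
    ultimately show ?thesis using t(2) presents_fill by blast
  qed
  then show ?thesis by blast
qed

section \<open>Running a machine on a block of tapes\<close>

fun retape :: "(nat \<Rightarrow> nat) \<Rightarrow> 's instr \<Rightarrow> 's instr" where
  "retape g (Act k d) = Act (g k) d"
| "retape g (Query k p q) = Query (g k) p q"

fun tape_of :: "'s instr \<Rightarrow> nat" where
  "tape_of (Act k d) = k"
| "tape_of (Query k p q) = k"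

definition width :: "'s machine \<Rightarrow> nat" where
  "width M = Suc (Max (insert 0 (tape_of ` set M)))"

lemma tape_of_less_width: "i \<in> set M \<Longrightarrow> tape_of i < width M"
  by (simp add: width_def less_Suc_eq_le)

lemma tape_of_relabel [simp]: "tape_of (relabel f i) = tape_of i"
  by (cases i) auto

text \<open>The run depends only on the \<open>K\<close> tapes on which \<open>c\<close> and
  \<open>d\<close> agree; injectivity of \<open>g\<close> keeps a write from disturbing another tape
  of the block.\<close>

lemma reach_retape:
  assumes "reach R M (q, d) (q', d')"
    and M: "\<And>i. i \<in> set M \<Longrightarrow> tape_of i < K"
    and g: "inj_on g {..<K}"
    and c: "\<And>k. k < K \<Longrightarrow> c (g k) = d k"
  shows "\<exists>c'. reach R (map (retape g) M) (q, c) (q', c') \<and> (\<forall>k<K. c' (g k) = d' k) \<and>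
    (\<forall>j. j \<notin> g ` {..<K} \<longrightarrow> c' j = c j)"
proof -
  have "reach R M s s' \<Longrightarrow> \<forall>k<K. c (g k) = snd s k \<Longrightarrow>
    \<exists>c'. reach R (map (retape g) M) (fst s, c) (fst s', c') \<and> (\<forall>k<K. c' (g k) = snd s' k) \<and>
      (\<forall>j. j \<notin> g ` {..<K} \<longrightarrow> c' j = c j)" for s s'
  proof (induction arbitrary: c rule: reach_induct)
    case refl
    then show ?case by (intro exI[of _ c]) simp
  next
    case (step s)
    obtain q d where s: "s = (q, d)" by fastforce
    obtain q1 d1 where s1: "step R M s = (q1, d1)" by fastforce
    show ?case
    proof (cases "q < length M")
      case True
      have d: "c (g k) = d k" if "k < K" for k using step.prems that s by simp
      have "tape_of (M ! q) < K" using M[OF nth_mem[OF True]] .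
      then have "\<exists>c1. step R (map (retape g) M) (q, c) = (q1, c1) \<and> (\<forall>k<K. c1 (g k) = d1 k) \<and>
        (\<forall>j. j \<notin> g ` {..<K} \<longrightarrow> c1 j = c j)"
        using True s1 d
        by (cases "M ! q") (auto simp: s inj_on_eq_iff[OF g] split: prod.splits if_splits)
      then obtain c1 where c1: "step R (map (retape g) M) (q, c) = (q1, c1)"
        "\<forall>k<K. c1 (g k) = d1 k" "\<forall>j. j \<notin> g ` {..<K} \<longrightarrow> c1 j = c j" by blast
      obtain c' where "reach R (map (retape g) M) (q1, c1) (fst s', c')"
        "\<forall>k<K. c' (g k) = snd s' k" "\<forall>j. j \<notin> g ` {..<K} \<longrightarrow> c' j = c1 j"
        using step.IH[of c1] c1(2) s1 by auto
      with c1 show ?thesis unfolding s fst_conv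
        by (metis reach_step)
    next
      case False
      then show ?thesis using step.IH[of c] step.prems s by simp
    qed
  qed
  from this[OF assms(1)] c show ?thesis by simp
qed

fun erase_all :: "nat list \<Rightarrow> 's::alphabet machine" where
  "erase_all [] = []"
| "erase_all (k # ks) = erase k ;; erase_all ks"

lemma exec_erase_all:
  assumes "\<And>k. k \<in> set ks \<Longrightarrow> seg (c k)"
  shows "\<exists>c'. exec R (erase_all ks) c c' \<and> (\<forall>k\<in>set ks. presents (c' k) (\<lambda>_. blank)) \<and>
    (\<forall>k. k \<notin> set ks \<longrightarrow> c' k = c k)"
  using assms
proof (induction ks arbitrary: c)
  case Nil
  then show ?case using exec_Nil by auto
next
  case (Cons k ks)
  obtain t where t: "exec R (erase k) c (c(k := t))" "presents t (\<lambda>_. blank)"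
    using exec_erase[of c k R] Cons.prems[of k] by auto
  have "seg ((c(k := t)) j)" if "j \<in> set ks" for j
    using Cons.prems[of j] that t(2) by (cases "j = k") (simp_all add: presents_iff)
  then obtain c' where c': "exec R (erase_all ks) (c(k := t)) c'"
      "\<forall>k\<in>set ks. presents (c' k) (\<lambda>_. blank)" "\<forall>j. j \<notin> set ks \<longrightarrow> c' j = (c(k := t)) j"
    using Cons.IH[of "c(k := t)"] by blast
  have "presents (c' k) (\<lambda>_. blank)"
    using c'(2,3) t(2) by (cases "k \<in> set ks") simp_all
  then show ?case
    using c' exec_seq[OF t(1) c'(1)] by (intro exI[of _ c']) simp
qed


text \<open>\<open>outputs\<close> accepts every state from \<open>length M\<close> on; all of them
  are collapsed to the single exit that \<open>exec\<close> requires.\<close>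

definition halting :: "'s machine \<Rightarrow> 's machine" where
  "halting M = map (relabel (min (length M))) M"

lemma exec_halting:
  assumes "reach R M (0, c) (q, c')" "length M \<le> q"
  shows "exec R (halting M) c c'"
proof -
  have "reach R (halting M) (min (length M) 0, c) (min (length M) q, c')"
    by (rule reach_embed[OF assms(1)]) (simp add: halting_def)
  then show ?thesis using assms(2) by (simp add: exec_def halting_def)
qed

text \<open>\<open>outputs\<close> promises only the content of tape 0 and nothing about the work
  tapes. Filling the scanned cell and erasing the rest restore the conditions for another
  call.\<close>

definition call :: "nat \<Rightarrow> (nat \<Rightarrow> nat) \<Rightarrow> 's::alphabet machine \<Rightarrow> 's machine" where
  "call K g M = map (retape g) (halting M) ;; mv (g 0) Stay ;; erase_all (map g [1..<K])"

lemma presents_blank: "presents (\<lambda>i. if i = 0 then Some blank else None) (\<lambda>_. blank)"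
  by (auto simp: presents_def content_def fun_eq_iff intro!: exI[of _ 0])

lemma exec_call:
  assumes M: "outputs R M \<tau> \<upsilon>" "width M \<le> K"
    and g: "inj_on g {..<K}"
    and c: "presents (c (g 0)) (cell \<tau>)" "\<And>k. k \<in> {1..<K} \<Longrightarrow> presents (c (g k)) (\<lambda>_. blank)"
  shows "\<exists>c'. exec R (call K g M) c c' \<and> presents (c' (g 0)) (cell \<upsilon>) \<and>
    (\<forall>k\<in>{1..<K}. presents (c' (g k)) (\<lambda>_. blank)) \<and> (\<forall>j. j \<notin> g ` {..<K} \<longrightarrow> c' j = c j)"
proof -
  have K: "0 < K" using M(2) by (simp add: width_def)
  \<comment> \<open>Outside of the block \<open>c\<close> holds other data, whereas
    \<open>outputs\<close> expects blank tapes there; \<open>d\<close> supplies them, and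
    \<open>M\<close> never scans them.\<close>
  define d where "d k = (if k < K then c (g k) else (\<lambda>i. if i = 0 then Some blank else None))" for k
  have d: "presents (d 0) (cell \<tau>) \<and> (\<forall>k>0. presents (d k) (\<lambda>_. blank))"
    using c K by (simp add: d_def presents_blank)
  then obtain n q d' where "(step R M ^^ n) (0, d) = (q, d')" "length M \<le> q"
      and out: "content (d' 0) = cell \<upsilon>"
    using M(1) unfolding outputs_def by blast
  then have "exec R (halting M) d d'"
    using exec_halting unfolding reach_def by blast
  moreover have "tape_of i < K" if "i \<in> set (halting M)" for i
    using that M(2) tape_of_less_width by (fastforce simp: halting_def)
  ultimately obtain c1 where c1: "exec R (map (retape g) (halting M)) c c1"
      "\<forall>k<K. c1 (g k) = d' k" "\<forall>j. j \<notin> g ` {..<K} \<longrightarrow> c1 j = c j"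
    using reach_retape[of R "halting M" 0 d "length (halting M)" d' K g c] g
    unfolding exec_def by (auto simp: d_def)
  define c2 where "c2 = c1(g 0 := fill (c1 (g 0)))"
  have c2: "exec R (mv (g 0) Stay) c1 c2"
    using exec_mv[of R "g 0" Stay c1] by (simp add: c2_def shift_Stay)
  have seg1: "seg (c1 (g k))" if "k < K" for k
  proof (rule seg_exec[OF c1(1)])
    show "seg (c (g k))" using c that by (cases "k = 0") (simp_all add: presents_iff)
  qed
  have img: "set (map g [1..<K]) = g ` {1..<K}" by simp
  have "seg (c2 k)" if "k \<in> set (map g [1..<K])" for k
    using that seg1 by (auto simp: c2_def seg_fill)
  then obtain c3 where c3: "exec R (erase_all (map g [1..<K])) c2 c3"
      "\<forall>k\<in>g ` {1..<K}. presents (c3 k) (\<lambda>_. blank)" "\<forall>k. k \<notin> g ` {1..<K} \<longrightarrow> c3 k = c2 k"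
    using exec_erase_all[of "map g [1..<K]" c2 R] unfolding img by blast
  have g0: "g 0 \<notin> g ` {1..<K}" using g K by (auto simp: inj_on_eq_iff)
  then have "c3 (g 0) = fill (d' 0)" using c3(3) c1(2) K by (simp add: c2_def)
  moreover have "presents (fill (d' 0)) (cell \<upsilon>)"
    using out seg1[OF K] c1(2) K by (auto intro: presents_fill)
  moreover have "c3 j = c j" if j: "j \<notin> g ` {..<K}" for j
  proof -
    have "j \<notin> g ` {1..<K}" "j \<noteq> g 0" using j K by auto
    then show ?thesis using j c3(3) c1(3) by (simp add: c2_def)
  qed
  moreover have "exec R (call K g M) c c3"
    unfolding call_def by (intro exec_seq[OF c1(1)] exec_seq[OF c2] c3(1))
  ultimately show ?thesis using c3(2) by (intro exI[of _ c3]) simp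
qed

section \<open>Computable functions\<close>

definition initial :: "'s::alphabet tape \<Rightarrow> (nat \<Rightarrow> 's mtape) \<Rightarrow> bool" where
  "initial \<tau> c \<longleftrightarrow> presents (c 0) (cell \<tau>) \<and> (\<forall>k>0. presents (c k) (\<lambda>_. blank))"

lemma computable_onI:
  fixes f :: "'s::alphabet tape \<Rightarrow> 's tape"
  assumes "\<And>\<tau> c. \<tau> \<in> Q \<Longrightarrow> initial \<tau> c \<Longrightarrow> \<exists>c'. exec R P c c' \<and> content (c' 0) = cell (f \<tau>)"
  shows "computable_on R Q f"
  unfolding computable_on_def outputs_def
proof (intro exI[of _ P] ballI allI impI)
  fix \<tau> and c :: "nat \<Rightarrow> 's mtape"
  assume "\<tau> \<in> Q" "presents (c 0) (cell \<tau>) \<and> (\<forall>k>0. presents (c k) (\<lambda>_. blank))"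
  then obtain c' where "exec R P c c'" "content (c' 0) = cell (f \<tau>)"
    using assms unfolding initial_def by blast
  then show "\<exists>n q c'. (step R P ^^ n) (0, c) = (q, c') \<and> length P \<le> q \<and> content (c' 0) = cell (f \<tau>)"
    unfolding exec_def reach_def by blast
qed

lemma computable_on_cong:
  "computable_on R Q f \<Longrightarrow> (\<And>\<tau>. \<tau> \<in> Q \<Longrightarrow> f \<tau> = g \<tau>) \<Longrightarrow> computable_on R Q g"
  by (simp add: computable_on_def)

lemma computable_on_comp:
  fixes f g :: "'s::alphabet tape \<Rightarrow> 's tape"
  assumes "computable_on R Q f" "computable_on R (f ` Q) g"
  shows "computable_on R Q (g \<circ> f)"
proof -
  obtain M N where M: "\<And>\<tau>. \<tau> \<in> Q \<Longrightarrow> outputs R M \<tau> (f \<tau>)"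
    and N: "\<And>\<tau>. \<tau> \<in> Q \<Longrightarrow> outputs R N (f \<tau>) (g (f \<tau>))"
    using assms unfolding computable_on_def by blast
  \<comment> \<open>With a common block size, the first call leaves blank every work tape that the
    second one uses.\<close>
  define K where "K = max (width M) (width N)"
  show ?thesis
  proof (rule computable_onI)
    fix \<tau> and c :: "nat \<Rightarrow> 's mtape"
    assume \<tau>: "\<tau> \<in> Q" and "initial \<tau> c"
    then have c: "presents (c (id 0)) (cell \<tau>)" "\<And>k. k \<in> {1..<K} \<Longrightarrow> presents (c (id k)) (\<lambda>_. blank)"
      by (auto simp: initial_def)
    obtain c1 where c1: "exec R (call K id M) c c1" "presents (c1 (id 0)) (cell (f \<tau>))"
        "\<forall>k\<in>{1..<K}. presents (c1 (id k)) (\<lambda>_. blank)"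
      using exec_call[OF M[OF \<tau>], of K id c] c by (auto simp: K_def)
    obtain c2 where "exec R (call K id N) c1 c2" "presents (c2 (id 0)) (cell (g (f \<tau>)))"
      using exec_call[OF N[OF \<tau>], of K id c1] c1 by (auto simp: K_def)
    then show "\<exists>c'. exec R (call K id M ;; call K id N) c c' \<and> content (c' 0) = cell ((g \<circ> f) \<tau>)"
      using exec_seq[OF c1(1)] by (auto simp: presents_iff)
  qed
qed

lemma computable_on_one_symbol:
  fixes f :: "'s::alphabet tape \<Rightarrow> 's tape"
  assumes "\<And>s :: 's. s = blank"
  shows "computable_on R Q f"
proof (rule computable_onI)
  fix \<tau> and c :: "nat \<Rightarrow> 's mtape"
  have "content (c 0) = cell (f \<tau>)" using assms by (metis ext)
  then show "\<exists>c'. exec R [] c c' \<and> content (c' 0) = cell (f \<tau>)" using exec_Nil by blast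
qed

section \<open>Translation by search\<close>

text \<open>The input is \<open>X n\<close> for a least \<open>n\<close>; when the search gets
  there, the other block holds \<open>Y n\<close>, which is \<open>f (X n)\<close> whether or not
  \<open>X\<close> repeats.\<close>

lemma computable_on_search:
  fixes X Y :: "nat \<Rightarrow> 's::alphabet tape"
  assumes "computable_on R (range X) hX" "\<And>i. hX (X i) = X (Suc i)"
    and "computable_on R (range Y) hY" "\<And>i. hY (Y i) = Y (Suc i)"
    and f: "\<And>i. f (X i) = Y i"
  shows "computable_on R (range X) f"
proof (cases "\<exists>s :: 's. s \<noteq> blank")
  case False
  then show ?thesis by (intro computable_on_one_symbol) blast
next
  case True
  then obtain mark :: 's where mark: "mark \<noteq> blank" by blast
  obtain M N where M: "\<And>i. outputs R M (X i) (X (Suc i))"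
    and N: "\<And>i. outputs R N (Y i) (Y (Suc i))"
    using assms(1-4) unfolding computable_on_def by (metis rangeI)
  obtain WX where WX: "\<And>c. presents (c 3) (\<lambda>_. blank) \<Longrightarrow>
      \<exists>t. exec R WX c (c(3 := t)) \<and> presents t (cell (X 0))"
    using ex_write_tape[of 3 R "X 0"] by blast
  define K where "K = max (width M) (width N)"
  have K: "0 < K" "width M \<le> K" "width N \<le> K" by (auto simp: K_def width_def)
  obtain WY where WY: "\<And>c. presents (c (3 + K)) (\<lambda>_. blank) \<Longrightarrow>
      \<exists>t. exec R WY c (c(3 + K := t)) \<and> presents t (cell (Y 0))"
    using ex_write_tape[of "3 + K" R "Y 0"] by blast
  \<comment> \<open>Tapes 0, 1 and 2 hold the input, the mark of the origin and the flag; two blocks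
    of \<open>K\<close> tapes follow.\<close>
  define gX gY :: "nat \<Rightarrow> nat" where "gX k = 3 + k" and "gY k = 3 + K + k" for k
  have inj: "inj_on gX {..<K}" "inj_on gY {..<K}" by (auto simp: gX_def gY_def inj_on_def)
  \<comment> \<open>\<open>cmp\<close> preserves the input and flags a difference, whereas
    \<open>copy\<close> overwrites the input and never touches the flag.\<close>
  define cmp where "cmp = lockstep.sweep mark 0 3 1 2 (\<lambda>s t. s) (\<lambda>s t. s \<noteq> t)"
  define copy where "copy = lockstep.sweep mark 0 (3 + K) 1 2 (\<lambda>s t. t) (\<lambda>s t. False)"
  \<comment> \<open>A sweep can only raise the flag, so every round lowers it first.\<close>
  define body where "body = wr 2 blank ;; call K gX M ;; call K gY N ;; cmp"
  define P where "P = wr 1 mark ;; WX ;; WY ;; cmp ;; loop 2 (\<lambda>v. sym v = mark) body ;; copy"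

  define frame where "frame \<tau> c \<longleftrightarrow> presents (c 0) (cell \<tau>) \<and>
    presents (c 1) (\<lambda>i. if i = 0 then mark else blank) \<and>
    (\<forall>k\<in>{1..<K}. presents (c (gX k)) (\<lambda>_. blank) \<and> presents (c (gY k)) (\<lambda>_. blank))"
    for \<tau> :: "'s tape" and c
  define ready where "ready \<tau> i c \<longleftrightarrow> frame \<tau> c \<and> presents (c 3) (cell (X i)) \<and>
    presents (c (3 + K)) (cell (Y i))" for \<tau> i c
  define found where "found \<tau> i c \<longleftrightarrow> ready \<tau> i c \<and> content (c 2) 0 = (if \<tau> = X i then blank else mark)"
    for \<tau> i c

  have cmp: "\<exists>c'. exec R cmp c c' \<and> found \<tau> i c'"
    if c: "ready \<tau> i c" "content (c 2) 0 = blank" for \<tau> i c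
  proof -
    interpret lockstep R mark 0 3 1 2 "\<lambda>s t. s" "\<lambda>s t. s \<noteq> t" "cell \<tau>" "cell (X i)" c
      by standard (use mark in auto)
    have pre: "presents (c 0) (cell \<tau>)" "presents (c 3) (cell (X i))"
      "presents (c 1) (\<lambda>i. if i = 0 then mark else blank)"
      using c(1) by (simp_all add: ready_def frame_def)
    obtain c' where c': "exec R cmp c c'" "presents (c' 0) (cell \<tau>)" "presents (c' 3) (cell (X i))"
      "presents (c' 1) (\<lambda>i. if i = 0 then mark else blank)"
      "c' 2 = (if \<exists>j. cell \<tau> j \<noteq> cell (X i) j then put mark (c 2) else c 2)"
      "\<forall>k. k \<notin> {0, 3, 1, 2} \<longrightarrow> c' k = c k"
      using exec_sweep[OF pre] unfolding cmp_def by blast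
    have "(\<exists>j. cell \<tau> j \<noteq> cell (X i) j) \<longleftrightarrow> \<tau> \<noteq> X i"
      by (metis cell_inject ext)
    then have "found \<tau> i c'"
      using c c' K(1) unfolding found_def ready_def frame_def
      by (auto simp: gX_def gY_def content_put)
    with c'(1) show ?thesis by blast
  qed

  have copy: "\<exists>c'. exec R copy c c' \<and> content (c' 0) = cell (Y i)" if c: "ready \<tau> i c" for \<tau> i c
  proof -
    interpret lockstep R mark 0 "3 + K" 1 2 "\<lambda>s t. t" "\<lambda>s t. False" "cell \<tau>" "cell (Y i)" c
      by standard (use mark in auto)
    have pre: "presents (c 0) (cell \<tau>)" "presents (c (3 + K)) (cell (Y i))"
      "presents (c 1) (\<lambda>i. if i = 0 then mark else blank)"
      using c by (simp_all add: ready_def frame_def)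
    show ?thesis
      using exec_sweep[OF pre] unfolding copy_def presents_iff by blast
  qed

  have body: "\<exists>c'. exec R body c c' \<and> found \<tau> (Suc i) c'" if c: "found \<tau> i c" for \<tau> i c
  proof -
    define c1 where "c1 = c(2 := put blank (c 2))"
    have c1: "exec R (wr 2 blank) c c1" using exec_wr[of R 2 blank c] by (simp add: c1_def)
    have at1: "ready \<tau> i c1"
      using c K(1) unfolding found_def ready_def frame_def by (auto simp: c1_def gX_def gY_def)
    then have X: "presents (c1 (gX 0)) (cell (X i))"
      "\<And>k. k \<in> {1..<K} \<Longrightarrow> presents (c1 (gX k)) (\<lambda>_. blank)"
      by (auto simp: ready_def frame_def gX_def)
    obtain c2 where c2: "exec R (call K gX M) c1 c2" "presents (c2 (gX 0)) (cell (X (Suc i)))"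
      "\<forall>k\<in>{1..<K}. presents (c2 (gX k)) (\<lambda>_. blank)" "\<forall>j. j \<notin> gX ` {..<K} \<longrightarrow> c2 j = c1 j"
      using exec_call[OF M K(2) inj(1), of c1, OF X] by auto
    have c2_eq: "c2 j = c1 j" if "j < 3 \<or> 3 + K \<le> j" for j
    proof -
      have "j \<notin> gX ` {..<K}" using that by (auto simp: gX_def)
      then show ?thesis using c2(4) by blast
    qed
    then have Y: "presents (c2 (gY 0)) (cell (Y i))"
      "\<And>k. k \<in> {1..<K} \<Longrightarrow> presents (c2 (gY k)) (\<lambda>_. blank)"
      using at1 by (auto simp: ready_def frame_def gY_def)
    obtain c3 where c3: "exec R (call K gY N) c2 c3" "presents (c3 (gY 0)) (cell (Y (Suc i)))"
      "\<forall>k\<in>{1..<K}. presents (c3 (gY k)) (\<lambda>_. blank)" "\<forall>j. j \<notin> gY ` {..<K} \<longrightarrow> c3 j = c2 j"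
      using exec_call[OF N K(3) inj(2), of c2, OF Y] by auto
    have c3_eq: "c3 j = c2 j" if "j < 3 + K" for j
    proof -
      have "j \<notin> gY ` {..<K}" using that by (auto simp: gY_def)
      then show ?thesis using c3(4) by blast
    qed
    have "ready \<tau> (Suc i) c3"
      using at1 c2(2,3) c3(2,3) K(1) unfolding ready_def frame_def
      by (auto simp: c2_eq c3_eq gX_def gY_def)
    moreover have "content (c3 2) 0 = blank"
      by (simp add: c2_eq c3_eq c1_def content_put)
    ultimately obtain c4 where "exec R cmp c3 c4" "found \<tau> (Suc i) c4"
      using cmp by blast
    then show ?thesis
      unfolding body_def using exec_seq[OF c1 exec_seq[OF c2(1) exec_seq[OF c3(1)]]] by blast
  qed

  show ?thesis
  proof (rule computable_onI[where P = P])
    fix \<tau> and c :: "nat \<Rightarrow> 's mtape"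
    assume "\<tau> \<in> range X" and init: "initial \<tau> c"
    define n where "n = (LEAST n. \<tau> = X n)"
    have n: "\<tau> = X n" unfolding n_def using \<open>\<tau> \<in> range X\<close> by (auto intro: LeastI)
    have less_n: "\<tau> \<noteq> X i" if "i < n" for i
      using not_less_Least[of i "\<lambda>n. \<tau> = X n"] that by (simp add: n_def)
    define c1 where "c1 = c(1 := put mark (c 1))"
    have c1: "exec R (wr 1 mark) c c1" using exec_wr[of R 1 mark c] by (simp add: c1_def)
    have "presents (c1 3) (\<lambda>_. blank)" using init by (simp add: c1_def initial_def)
    then obtain t where t: "exec R WX c1 (c1(3 := t))" "presents t (cell (X 0))"
      using WX by blast
    have "presents ((c1(3 := t)) (3 + K)) (\<lambda>_. blank)"
      using init K(1) by (simp add: c1_def initial_def)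
    then obtain t' where t': "exec R WY (c1(3 := t)) (c1(3 := t, 3 + K := t'))"
      "presents t' (cell (Y 0))"
      using WY by blast
    have "content (put mark (c 1)) = (\<lambda>i. if i = 0 then mark else blank)"
      using init by (auto simp: initial_def presents_iff content_put fun_eq_iff)
    then have "presents (put mark (c 1)) (\<lambda>i. if i = 0 then mark else blank)"
      using init by (simp add: initial_def presents_iff seg_put put_apply)
    then have "ready \<tau> 0 (c1(3 := t, 3 + K := t'))" "content ((c1(3 := t, 3 + K := t')) 2) 0 = blank"
      using init t(2) t'(2) K(1) unfolding ready_def frame_def
      by (auto simp: initial_def gX_def gY_def c1_def presents_iff)
    then obtain c2 where c2: "exec R cmp (c1(3 := t, 3 + K := t')) c2" "found \<tau> 0 c2"
      using cmp by blast

    have "\<exists>c'. exec R (loop 2 (\<lambda>v. sym v = mark) body) c2 c' \<and> (found \<tau> (n - 0) c' \<and> 0 \<le> n)"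
    \<comment> \<open>\<open>j\<close> rounds remain before the least index \<open>n\<close> is
      reached; minimality of \<open>n\<close> keeps the flag raised until then.\<close>
    proof (rule exec_countdown[where I = "\<lambda>j c. found \<tau> (n - j) c \<and> j \<le> n" and n = n])
      fix j c
      assume "found \<tau> (n - j) c \<and> j \<le> n"
      then show "found \<tau> (n - j) (c(2 := fill (c 2))) \<and> j \<le> n"
        using K(1) unfolding found_def ready_def frame_def by (auto simp: gX_def gY_def)
    next
      fix j c
      assume j: "found \<tau> (n - Suc j) c \<and> Suc j \<le> n"
      then have "Suc (n - Suc j) = n - j" by linarith
      then show "sym (c 2 0) = mark \<and> (\<exists>c'. exec R body c c' \<and> found \<tau> (n - j) c' \<and> j \<le> n)"
        using body[of \<tau> "n - Suc j" c] j less_n[of "n - Suc j"]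
        by (auto simp: found_def sym_eq_content)
    next
      fix c
      assume "found \<tau> (n - 0) c \<and> 0 \<le> n"
      then show "sym (c 2 0) \<noteq> mark" using n mark by (auto simp: found_def sym_eq_content)
    qed (use c2(2) in simp)
    then obtain c3 where c3: "exec R (loop 2 (\<lambda>v. sym v = mark) body) c2 c3" "ready \<tau> n c3"
      by (auto simp: found_def)
    obtain c4 where c4: "exec R copy c3 c4" "content (c4 0) = cell (Y n)"
      using copy[OF c3(2)] by blast
    have "exec R P c c4"
      unfolding P_def
      by (intro exec_seq[OF c1] exec_seq[OF t(1)] exec_seq[OF t'(1)] exec_seq[OF c2(1)]
          exec_seq[OF c3(1)] c4(1))
    then show "\<exists>c'. exec R P c c' \<and> content (c' 0) = cell (f \<tau>)"
      using c4(2) n f by auto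
  qed
qed

section \<open>Equivalence of representations\<close>

lemma inv_into_comp_image:
  assumes "inj_on x A"
  shows "(y \<circ> inv_into A x) ` x ` A = y ` A"
  using assms by (auto simp: image_comp)

text \<open>On the sequences \<open>x (e^i a0)\<close> and \<open>y (e^i a0)\<close> the two
  conjugates of \<open>e\<close> act as successor, and the translation matches them index by
  index.\<close>

lemma computable_translation:
  assumes x: "inj_on x A" and y: "inj_on y A"
    and e: "e \<in> A \<rightarrow> A" "a0 \<in> A" "\<And>a. a \<in> A \<Longrightarrow> \<exists>i. a = (e ^^ i) a0"
    and ex: "computable_on R (x ` A) (x \<circ> e \<circ> inv_into A x)"
    and ey: "computable_on R (y ` A) (y \<circ> e \<circ> inv_into A y)"
  shows "computable_on R (x ` A) (y \<circ> inv_into A x)"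
proof -
  have mem: "(e ^^ i) a0 \<in> A" for i
    using e(1,2) by (induction i) auto
  have A: "range (\<lambda>i. (e ^^ i) a0) = A" using mem by (auto dest!: e(3))
  have range: "x ` A = range (\<lambda>i. x ((e ^^ i) a0))" "y ` A = range (\<lambda>i. y ((e ^^ i) a0))"
    by (subst A[symmetric], simp add: image_image)+
  show ?thesis
    unfolding range
    by (rule computable_on_search[OF ex[unfolded range] _ ey[unfolded range]])
      (simp_all add: x y mem)
qed

lemma trans_equiv_if_generated:
  assumes "inj_on x A" "inj_on y A"
    and "e \<in> comp_funs R A x" "e \<in> comp_funs R A y"
    and "a0 \<in> A" "\<And>a. a \<in> A \<Longrightarrow> \<exists>i. a = (e ^^ i) a0"
  shows "trans_equiv R A x y"
proof -
  have "e \<in> A \<rightarrow> A" using assms(3) by (auto simp: comp_funs_def)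
  then show ?thesis
    using assms computable_translation[of x A y e a0 R] computable_translation[of y A x e a0 R]
    unfolding trans_equiv_def comp_funs_def by blast
qed

lemma trans_equiv_sym: "trans_equiv R A x y \<Longrightarrow> trans_equiv R A y x"
  by (simp add: trans_equiv_def)

lemma comp_funs_subset:
  assumes x: "inj_on x A" and y: "inj_on y A" and xy: "trans_equiv R A x y"
  shows "comp_funs R A x \<subseteq> comp_funs R A y"
proof
  fix g
  assume "g \<in> comp_funs R A x"
  then have g: "g \<in> A \<rightarrow>\<^sub>E A" "computable_on R (x ` A) (x \<circ> g \<circ> inv_into A x)"
    by (auto simp: comp_funs_def)
  have yx: "computable_on R (y ` A) (x \<circ> inv_into A y)"
    and xy: "computable_on R (x ` A) (y \<circ> inv_into A x)"
    using xy by (auto simp: trans_equiv_def)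
  have g_mem: "g a \<in> A" if "a \<in> A" for a using g(1) that by auto
  \<comment> \<open>Conjugation by the translations: y g y^-1 = (y x^-1) (x g x^-1) (x y^-1),
    composed from the right.\<close>
  have 1: "computable_on R (y ` A) ((x \<circ> g \<circ> inv_into A x) \<circ> (x \<circ> inv_into A y))"
    by (rule computable_on_comp[OF yx]) (simp only: inv_into_comp_image[OF y] g(2))
  have "((x \<circ> g \<circ> inv_into A x) \<circ> (x \<circ> inv_into A y)) ` y ` A \<subseteq> x ` A"
    using x y g_mem by auto
  then have "computable_on R (((x \<circ> g \<circ> inv_into A x) \<circ> (x \<circ> inv_into A y)) ` y ` A) (y \<circ> inv_into A x)"
    using xy unfolding computable_on_def by blast
  from computable_on_comp[OF 1 this]
  have "computable_on R (y ` A) (y \<circ> g \<circ> inv_into A y)"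
    by (rule computable_on_cong) (use x y g_mem in auto)
  then show "g \<in> comp_funs R A y" using g(1) by (simp add: comp_funs_def)
qed

lemma trans_equiv_if_comp_funs_subset:
  assumes x: "inj_on x A" and y: "inj_on y A"
    and "ce R (x ` A)" and sub: "comp_funs R A x \<subseteq> comp_funs R A y"
  shows "trans_equiv R A x y"
proof -
  obtain h \<tau>0 where h: "computable_on R (x ` A) h" "h \<in> x ` A \<rightarrow> x ` A" "\<tau>0 \<in> x ` A"
      "\<And>\<tau>. \<tau> \<in> x ` A \<Longrightarrow> \<exists>i. \<tau> = (h ^^ i) \<tau>0"
    using assms(3) unfolding ce_def by blast
  obtain a0 where a0: "a0 \<in> A" "\<tau>0 = x a0" using h(3) by blast
  \<comment> \<open>The conjugate of \<open>h\<close> by \<open>x\<close>, restricted because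
    \<open>comp_funs\<close> contains only functions that are \<open>undefined\<close> outside of
    \<open>A\<close>.\<close>
  define e where "e = restrict (inv_into A x \<circ> h \<circ> x) A"
  have x_e: "x (e a) = h (x a)" "e a \<in> A" if "a \<in> A" for a
  proof -
    have "h (x a) \<in> x ` A" using h(2) that by blast
    then show "x (e a) = h (x a)" "e a \<in> A"
      using that by (simp_all add: e_def f_inv_into_f inv_into_into)
  qed
  have iter: "(e ^^ i) a0 \<in> A \<and> x ((e ^^ i) a0) = (h ^^ i) \<tau>0" for i
    by (induction i) (use a0 x_e in auto)
  have "computable_on R (x ` A) (x \<circ> e \<circ> inv_into A x)"
    using h(1) by (rule computable_on_cong) (use x x_e in auto)
  moreover have "e \<in> A \<rightarrow>\<^sub>E A" using x_e(2) by (auto simp: e_def)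
  ultimately have e: "e \<in> comp_funs R A x" by (simp add: comp_funs_def)
  have "\<exists>i. a = (e ^^ i) a0" if "a \<in> A" for a
  proof -
    obtain i where "x a = (h ^^ i) \<tau>0" using h(4)[of "x a"] \<open>a \<in> A\<close> by blast
    then have "x a = x ((e ^^ i) a0)" using iter by simp
    then show ?thesis using x that iter by (metis inj_onD)
  qed
  then show ?thesis using trans_equiv_if_generated[OF x y e _ a0(1)] e sub by blast
qed

theorem theorem14:
  fixes R :: "'s::alphabet tape set"
    and A :: "'a set"
    and x y :: "'a \<Rightarrow> 's tape"
  assumes "countable A"
    and "representation A x"
    and "representation A y"
  shows "(ce R (x ` A) \<and> ce R (y ` A) \<longrightarrow>
      (trans_equiv R A x y \<or>
        (\<not> comp_funs R A x \<subseteq> comp_funs R A y \<and> \<not> comp_funs R A y \<subseteq> comp_funs R A x)) \<and>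
      \<not> (trans_equiv R A x y \<and>
        (\<not> comp_funs R A x \<subseteq> comp_funs R A y \<and> \<not> comp_funs R A y \<subseteq> comp_funs R A x))) \<and>
    (\<forall>e a0. e \<in> A \<rightarrow>\<^sub>E A \<and> a0 \<in> A \<and> (\<forall>a\<in>A. \<exists>i. a = (e ^^ i) a0) \<and>
      e \<in> comp_funs R A x \<and> e \<in> comp_funs R A y \<longrightarrow> trans_equiv R A x y)"
proof -
  have x: "inj_on x A" and y: "inj_on y A"
    using assms by (auto simp: representation_def)
  have "trans_equiv R A x y"
    if "ce R (x ` A)" "ce R (y ` A)"
      "comp_funs R A x \<subseteq> comp_funs R A y \<or> comp_funs R A y \<subseteq> comp_funs R A x"
    using that trans_equiv_if_comp_funs_subset[OF x y] trans_equiv_if_comp_funs_subset[OF y x]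
      trans_equiv_sym by blast
  \<comment> \<open>Equivalence yields an inclusion, so the two alternatives of (i) exclude each
    other.\<close>
  moreover have "comp_funs R A x \<subseteq> comp_funs R A y" if "trans_equiv R A x y"
    using comp_funs_subset[OF x y that] .
  moreover have "trans_equiv R A x y"
    if "e \<in> comp_funs R A x" "e \<in> comp_funs R A y" "a0 \<in> A" "\<forall>a\<in>A. \<exists>i. a = (e ^^ i) a0" for e a0
    using trans_equiv_if_generated[OF x y that(1-3)] that(4) by blast
  ultimately show ?thesis by blast
qed

end
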